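(* Let $m\geq 1$ and $N_1,\dots,N_m\geq 0$ be integers, $N=\sum_{i=1}^{m}N_i$, and let $q,C,x,A_1,\dots,A_m$ be nonzero complex numbers such that none of the denominators involved vanish. Then $${}_{8+2m}V_{7+2m}\big(C^2;\,C/x,\,Cx,\,q^{-N},\,A_1Cq^{N_1},\ldots,A_mCq^{N_m},\,Cq/A_1,\ldots,Cq/A_m;\,q,p\big)$$ $$=\frac{(q,C^2q;q,p)_{N}}{(Cxq,Cq/x;q,p)_{N}}\prod_{i=1}^m\frac{(A_ix,A_i/x;q,p)_{N_i}}{(A_iC,A_i/C;q,p)_{N_i}}.$$
   Context: Let $p\in\mathbb{C}$, $|p|<1$. The modified Jacobi theta function is $\theta(x;p)=\prod_{n=0}^{\infty}(1-xp^n)(1-p^{n+1}/x)$ for $x\ne 0$. The theta $q,p$-shifted factorial is $(x;q,p)_n=\prod_{k=0}^{n-1}\theta(xq^k;p)$, and $(x_1,\dots,x_r;q,p)_n=\prod_{k=1}^r(x_k;q,p)_n$. Empty products equal $1$. The very-well-poised elliptic hypergeometric series (with argument $1$) is $${}_{r+1}V_{r}(a_1;a_6,\ldots,a_{r+1};q,p)=\sum_{n=0}^{\infty}\frac{\theta(a_1q^{2n};p)}{\theta(a_1;p)}\,\frac{(a_{1},a_6,\ldots,a_{r+1};q,p)_n}{(q,a_{1}q/a_6,\ldots,a_{1}q/a_{r+1};q,p)_n}\,q^n .$$ In the claim the series is terminating: since $q^{-N}$ is one of the parameters, only the terms $0\le n\le N$ contribute (the series is the sum over $0\le n\le N$). 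*)

theory Defs
  imports "HOL-Analysis.Analysis"
begin

definition jtheta :: "complex \<Rightarrow> complex \<Rightarrow> complex" where
  "jtheta x p = (\<Prod>n. (1 - x * p ^ n) * (1 - p ^ (n + 1) / x))"

definition theta_fact :: "complex \<Rightarrow> complex \<Rightarrow> complex \<Rightarrow> nat \<Rightarrow> complex" where
  "theta_fact x q p n = (\<Prod>k<n. jtheta (x * q ^ k) p)"

definition theta_facts :: "complex list \<Rightarrow> complex \<Rightarrow> complex \<Rightarrow> nat \<Rightarrow> complex" where
  "theta_facts xs q p n = (\<Prod>x\<leftarrow>xs. theta_fact x q p n)"

text \<open>
  \<open>ellV a [a\<^sub>6, \<dots>, a\<^sub>r\<^sub>+\<^sub>1] q p\<close> is the series with \<open>a = a\<^sub>1\<close> and argument 1; the indices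
  \<open>r + 1\<close> and \<open>r\<close> are not arguments, as \<open>r + 1\<close> is the length of the list plus 5.
  If \<open>q\<^sup>-\<^sup>N\<close> is in the list, all terms with \<open>n > N\<close> are 0: the numerator contains the factor
  \<open>jtheta 1 p = 0\<close>, and this holds even where the denominator vanishes since \<open>0 / 0 = 0\<close>.
\<close>

definition ellV :: "complex \<Rightarrow> complex list \<Rightarrow> complex \<Rightarrow> complex \<Rightarrow> complex" where
  "ellV a bs q p =
     (\<Sum>n. jtheta (a * q ^ (2 * n)) p / jtheta a p *
          (theta_facts (a # bs) q p n / theta_facts (q # map (\<lambda>b. a * q / b) bs) q p n) * q ^ n)"

end

theory Submission
  imports Defs
begin

text \<open>
  As a function of \<open>x\<close>, the right-hand side is a constant times \<open>F x\<close> divided by the product of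
  \<open>\<theta>(C q\<^sup>j x) \<theta>(C q\<^sup>j / x)\<close> over \<open>1 \<le> j \<le> N\<close>, where \<open>F x\<close> is the product of the
  \<open>(A\<^sub>i x)\<^bsub>N\<^sub>i\<^esub> (A\<^sub>i / x)\<^bsub>N\<^sub>i\<^esub>\<close> and so a product of \<open>N\<close> functions \<open>\<theta>(a x) \<theta>(a / x)\<close>. These functions
  all lie in one two-dimensional space, and \<open>F\<close> behaves like a polynomial of degree \<open>N\<close>: it is
  recovered from its values at \<open>N + 1\<close> nodes by a Lagrange formula (\<open>theta_interpolation\<close>).
  For the nodes \<open>C q\<^sup>k\<close> with \<open>0 \<le> k \<le> N\<close>, the term of the node \<open>C q\<^sup>k\<close>, with the same constant and
  the same divisor as \<open>F x\<close>, is the \<open>k\<close>-th summand of the series (\<open>vwp_sum_generic\<close>).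
  To see this, one shifts the ranges of theta shifted factorials and inverts their factors by
  \<open>\<theta>(1 / x) = - \<theta>(x) / x\<close>.

  The two-dimensional space comes from \<open>jtheta_determinant\<close>: there are functions \<open>u\<close> and \<open>v\<close> with
  \<open>\<theta>(x y) \<theta>(x / y) / x = u(x) v(y) - v(x) u(y)\<close>. The Jacobi triple product writes the left-hand side
  as a double series, and its terms with even and with odd index sum give the two products.
  From this representation the interpolation formula is pure algebra, by induction on \<open>N\<close>.

  Interpolation needs \<open>\<theta>(C\<^sup>2 q\<^sup>j) \<noteq> 0\<close> for \<open>1 \<le> j \<le> N\<close>, as otherwise the values at some two nodes
  are dependent. This condition fails only for countably many \<open>C\<close>. Both sides are continuous in
  \<open>C\<close> where their denominators do not vanish, so the exceptional cases follow by a limit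
  (\<open>vwp_sum\<close>).
\<close>

(* Frees the infix for absolute summability in the sense of infsetsum. *)
no_notation Infinite_Sum.abs_summable_on (infixr \<open>abs'_summable'_on\<close> 46)

section \<open>The theta product\<close>

text \<open>
  The factors of the theta product tend to 1 geometrically, at a rate that is locally uniform
  in \<open>x \<noteq> 0\<close>; convergence and continuity of \<^const>\<open>jtheta\<close> both rest on this bound.
\<close>

lemma jtheta_factor_bound:
  fixes p x :: complex
  assumes "norm p < 1" "x \<noteq> 0"
  shows "norm ((1 - x * p ^ n) * (1 - p ^ (n + 1) / x) - 1)
           \<le> (norm x + norm (p / x) + norm p) * norm p ^ n"
proof -
  have eq: "(1 - x * p ^ n) * (1 - p ^ (n + 1) / x) - 1 =
      - (x * p ^ n) - (p / x) * p ^ n + p * p ^ n * p ^ n"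
    using assms(2) by (simp add: field_simps)
  have "norm (- (x * p ^ n) - (p / x) * p ^ n + p * p ^ n * p ^ n)
      \<le> norm (x * p ^ n) + norm ((p / x) * p ^ n) + norm (p * p ^ n * p ^ n)"
    by (metis (no_types, opaque_lifting) norm_triangle_mono norm_triangle_ineq4 norm_minus_cancel order_refl)
  also have "norm (p * p ^ n * p ^ n) \<le> norm p * norm p ^ n"
    using assms(1) by (simp add: norm_mult norm_power mult_left_le power_le_one)
  finally show ?thesis
    unfolding eq by (simp add: norm_mult norm_power norm_divide algebra_simps)
qed

lemma jtheta_convergent:
  fixes p x :: complex
  assumes "norm p < 1" "x \<noteq> 0"
  shows "convergent_prod (\<lambda>n. (1 - x * p ^ n) * (1 - p ^ (n + 1) / x))"
proof -
  have "summable (\<lambda>n. (norm x + norm (p / x) + norm p) * norm p ^ n)"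
    using assms(1) by (intro summable_mult summable_geometric) auto
  then have "summable (\<lambda>n. norm ((1 - x * p ^ n) * (1 - p ^ (n + 1) / x) - 1))"
    by (rule summable_comparison_test') (use jtheta_factor_bound[OF assms] in simp)
  then show ?thesis
    by (intro abs_convergent_prod_imp_convergent_prod) (simp only: abs_convergent_prod_conv_summable)
qed

lemma jtheta_LIMSEQ:
  assumes "norm p < 1" "x \<noteq> 0"
  shows "(\<lambda>M. \<Prod>n<M. (1 - x * p ^ n) * (1 - p ^ (n + 1) / x)) \<longlonglongrightarrow> jtheta x p"
  using convergent_prod_LIMSEQ[OF jtheta_convergent[OF assms]]
  unfolding jtheta_def by (simp add: LIMSEQ_lessThan_iff_atMost)

text \<open>
  A convergent product vanishes only if one of its factors does. What matters later is that
  this leaves countably many zeros.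
\<close>

lemma jtheta_zeros:
  assumes "norm p < 1" "x \<noteq> 0" "jtheta x p = 0"
  shows "x \<in> range (\<lambda>n. 1 / p ^ n) \<union> range (\<lambda>n. p ^ (n + 1))"
proof -
  have "\<not> (\<forall>n. (1 - x * p ^ n) * (1 - p ^ (n + 1) / x) \<noteq> 0)"
    using prodinf_nonzero[OF jtheta_convergent[OF assms(1,2)]] assms(3)
    unfolding jtheta_def by auto
  then obtain n where "x * p ^ n = 1 \<or> p ^ (n + 1) / x = 1"
    by auto
  then show ?thesis
  proof
    assume *: "x * p ^ n = 1"
    then have "p ^ n \<noteq> 0" by (intro notI) simp
    then have "x = 1 / p ^ n" using * by (rule eq_divide_imp)
    then show ?thesis by blast
  next
    assume "p ^ (n + 1) / x = 1"
    then have "x = p ^ (n + 1)" using assms(2) by (simp add: field_simps)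
    then show ?thesis by blast
  qed
qed

lemma jtheta_1 [simp]:
  assumes "norm p < 1"
  shows "jtheta 1 p = 0"
proof -
  have "eventually (\<lambda>M. 0 = (\<Prod>n<M. (1 - 1 * p ^ n) * (1 - p ^ (n + 1) / 1))) sequentially"
    using eventually_gt_at_top[of 0]
  proof eventually_elim
    case (elim M)
    then show ?case by (intro prod_zero[symmetric]) (auto intro!: bexI[of _ 0])
  qed
  then have "(\<lambda>M. \<Prod>n<M. (1 - 1 * p ^ n) * (1 - p ^ (n + 1) / 1)) \<longlonglongrightarrow> 0"
    by (rule Lim_transform_eventually[OF tendsto_const])
  then show ?thesis
    using jtheta_LIMSEQ[OF assms, of 1] LIMSEQ_unique by fastforce
qed

text \<open>
  Replacing \<open>x\<close> by \<open>1 / x\<close> turns the partial products into each other up to one factor at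
  either end; the far one tends to 1 and the near one gives \<open>- 1 / x\<close>.
\<close>

lemma jtheta_inverse:
  assumes p: "norm p < 1" and x: "x \<noteq> 0"
  shows "jtheta (1 / x) p = - jtheta x p / x"
proof (cases "x = 1")
  case True
  then show ?thesis using p by simp
next
  case False
  define P where "P x M = (\<Prod>n<M. (1 - x * p ^ n) * (1 - p ^ (n + 1) / x))" for x M
  have fin: "P x M * (1 - 1 / x) * (1 - x * p ^ M) = P (1 / x) M * (1 - x) * (1 - p ^ M / x)" for M
    by (induction M) (use x in \<open>simp_all add: P_def mult_ac\<close>)
  have pM: "(\<lambda>M. p ^ M) \<longlonglongrightarrow> 0"
    using p by (rule LIMSEQ_power_zero)
  have L: "(\<lambda>M. P x M * (1 - 1 / x) * (1 - x * p ^ M)) \<longlonglongrightarrow> jtheta x p * (1 - 1 / x) * (1 - x * 0)"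
    unfolding P_def by (intro tendsto_intros jtheta_LIMSEQ p pM x)
  have R: "(\<lambda>M. P (1 / x) M * (1 - x) * (1 - p ^ M / x)) \<longlonglongrightarrow> jtheta (1 / x) p * (1 - x) * (1 - 0 / x)"
    unfolding P_def by (intro tendsto_intros jtheta_LIMSEQ p pM x) (use x in simp)
  have "jtheta x p * (1 - 1 / x) = jtheta (1 / x) p * (1 - x)"
    using LIMSEQ_unique[OF L] R fin by simp
  then have "jtheta x p * (x - 1) = jtheta (1 / x) p * (1 - x) * x"
    using x by (simp add: field_simps)
  then have "(jtheta x p + jtheta (1 / x) p * x) * (x - 1) = 0"
    by (simp add: algebra_simps)
  then have "jtheta x p + jtheta (1 / x) p * x = 0"
    using False by simp
  then have "jtheta (1 / x) p * x = - jtheta x p"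
    by (simp add: eq_neg_iff_add_eq_0 add.commute)
  then show ?thesis
    using x by (simp add: field_simps)
qed

lemma continuous_on_jtheta_compact:
  assumes p: "norm p < 1" and K: "compact K" "0 \<notin> K"
  shows "continuous_on K (\<lambda>x. jtheta x p)"
proof -
  define f where "f n x = (1 - x * p ^ n) * (1 - p ^ (n + 1) / x)" for n :: nat and x :: complex
  have cont: "continuous_on K (f n)" for n
    unfolding f_def using K(2) by (intro continuous_intros) auto
  have "continuous_on K (\<lambda>x. norm x + norm (p / x) + norm p)"
    using K(2) by (intro continuous_intros) auto
  then have "bounded ((\<lambda>x. norm x + norm (p / x) + norm p) ` K)"
    using K(1) compact_continuous_image compact_imp_bounded by blast
  then obtain B where B: "\<And>x. x \<in> K \<Longrightarrow> norm x + norm (p / x) + norm p \<le> B"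
    by (force simp: bounded_real)
  have b: "norm (f n x - 1) \<le> B * norm p ^ n" if "x \<in> K" for n x
  proof -
    have x: "x \<noteq> 0" using that K(2) by auto
    have "norm (f n x - 1) \<le> (norm x + norm (p / x) + norm p) * norm p ^ n"
      unfolding f_def by (rule jtheta_factor_bound[OF p x])
    also have "\<dots> \<le> B * norm p ^ n"
      by (intro mult_right_mono B that) auto
    finally show ?thesis .
  qed
  have "summable (\<lambda>n. B * norm p ^ n)"
    using p by (intro summable_mult summable_geometric) auto
  then have "uniformly_convergent_on K (\<lambda>N x. \<Sum>n<N. norm (f n x - 1))"
    by (rule Weierstrass_m_test'[rotated]) (use b in auto)
  then have "uniformly_convergent_on K (\<lambda>N x. \<Prod>n<N. f n x)"
    by (intro uniformly_convergent_on_prod' cont K(1))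
  then obtain l where l: "uniform_limit K (\<lambda>N x. \<Prod>n<N. f n x) l sequentially"
    unfolding uniformly_convergent_on_def by blast
  have "continuous_on K l"
    by (rule uniform_limit_theorem[OF _ l]) (auto intro!: always_eventually continuous_on_prod cont)
  moreover have "l x = jtheta x p" if "x \<in> K" for x
    using tendsto_uniform_limitI[OF l that] jtheta_LIMSEQ[OF p, of x] LIMSEQ_unique that K(2)
    unfolding f_def by blast
  ultimately show ?thesis
    using continuous_on_cong by metis
qed

lemma isCont_jtheta:
  assumes p: "norm p < 1" and x: "x \<noteq> 0"
  shows "isCont (\<lambda>x. jtheta x p) x"
proof -
  have "continuous_on (cball x (norm x / 2)) (\<lambda>x. jtheta x p)"
    using x by (intro continuous_on_jtheta_compact p) (auto simp: dist_norm)
  then show ?thesis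
    by (rule continuous_on_interior) (use x in \<open>simp add: interior_cball\<close>)
qed

section \<open>The Jacobi triple product\<close>

definition tri :: "int \<Rightarrow> int" where
  "tri n = n * (n - 1) div 2"

lemma two_tri: "2 * tri n = n * (n - 1)"
  unfolding tri_def by (rule dvd_mult_div_cancel) auto

lemma tri_0 [simp]: "tri 0 = 0" and tri_1 [simp]: "tri 1 = 0"
  by (simp_all add: tri_def)

lemma tri_Suc: "tri (n + 1) = tri n + n"
  using two_tri[of "n + 1"] two_tri[of n] by (simp add: algebra_simps)

lemma tri_uminus: "tri (- n) = tri n + n"
  using two_tri[of "- n"] two_tri[of n] by (simp add: algebra_simps)

text \<open>
  This is \<open>(p; p)\<^sub>n\<close>; quotients of these are the Gaussian binomial coefficients in base \<open>p\<close>.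
\<close>

definition qfac :: "complex \<Rightarrow> nat \<Rightarrow> complex" where
  "qfac p n = (\<Prod>j<n. 1 - p ^ (j + 1))"

lemma qfac_0 [simp]: "qfac p 0 = 1"
  by (simp add: qfac_def)

lemma qfac_Suc: "qfac p (Suc n) = qfac p n * (1 - p ^ (n + 1))"
  by (simp add: qfac_def)

lemma one_minus_power_nonzero:
  fixes p :: complex
  assumes "norm p < 1"
  shows "1 - p ^ (j + 1) \<noteq> 0"
proof
  assume "1 - p ^ (j + 1) = 0"
  then have "norm (p ^ (j + 1)) = 1" by simp
  moreover have "norm (p ^ (j + 1)) < 1"
    using assms mult_left_le[of "norm p ^ j" "norm p"] power_le_one[of "norm p" j]
    by (simp add: norm_mult norm_power)
  ultimately show False by simp
qed

lemma qfac_nonzero: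
  assumes "norm p < 1"
  shows "qfac p n \<noteq> 0"
  unfolding qfac_def using one_minus_power_nonzero[OF assms] by auto

lemma qfac_LIMSEQ:
  assumes "norm p < 1"
  obtains L where "L \<noteq> 0" "qfac p \<longlonglongrightarrow> L"
proof -
  have "summable (\<lambda>j. norm p * norm p ^ j)"
    using assms by (intro summable_mult summable_geometric) auto
  then have "abs_convergent_prod (\<lambda>j. 1 - p ^ (j + 1))"
    by (simp add: abs_convergent_prod_conv_summable norm_mult norm_power)
  then have c: "convergent_prod (\<lambda>j. 1 - p ^ (j + 1))"
    by (rule abs_convergent_prod_imp_convergent_prod)
  show thesis
  proof
    show "prodinf (\<lambda>j. 1 - p ^ (j + 1)) \<noteq> 0"
      by (rule prodinf_nonzero[OF c one_minus_power_nonzero[OF assms]])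
    show "qfac p \<longlonglongrightarrow> prodinf (\<lambda>j. 1 - p ^ (j + 1))"
      using convergent_prod_LIMSEQ[OF c]
      unfolding qfac_def[abs_def] by (simp only: LIMSEQ_lessThan_iff_atMost)
  qed
qed

lemma gauss_binomial_theorem:
  fixes p z :: complex
  assumes p: "p \<noteq> 0" "norm p < 1"
  shows "(\<Prod>k<L. 1 - z * p ^ k) =
    (\<Sum>j\<le>L. (- z) ^ j * p powi tri (int j) * (qfac p L / (qfac p j * qfac p (L - j))))"
proof (induction L)
  case 0
  then show ?case by simp
next
  case (Suc L)
  \<comment> \<open>The summand, extended by 0 beyond \<open>L\<close>, so that the Pascal rule also covers the last index.\<close>
  define b where "b L j = (if j \<le> L then (- z) ^ j * p powi tri (int j) *
      (qfac p L / (qfac p j * qfac p (L - j))) else 0)" for L j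
  have b0: "b L 0 = 1" for L
    using qfac_nonzero[OF p(2)] by (simp add: b_def)
  have b_Suc: "b (Suc L) (Suc j) = b L (Suc j) - z * p ^ L * b L j" if j: "j \<le> L" for j
  proof -
    have pw: "p powi tri (int (Suc j)) = p powi tri (int j) * p ^ j"
      using p(1) tri_Suc[of "int j"] by (simp add: power_int_add algebra_simps)
    show ?thesis
    proof (cases "j = L")
      case True
      then show ?thesis
        using qfac_nonzero[OF p(2)] by (simp add: b_def pw[unfolded True, simplified])
    next
      case False
      then obtain d where d: "L = Suc (j + d)"
        using j less_imp_Suc_add[of j L] by auto
      have nz: "qfac p j \<noteq> 0" "qfac p d \<noteq> 0" "1 - p ^ (j + 1) \<noteq> 0" "1 - p ^ (d + 1) \<noteq> 0"
        using qfac_nonzero[OF p(2)] one_minus_power_nonzero[OF p(2)] by auto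
      have key: "qfac p (Suc L) / (qfac p (Suc j) * qfac p (Suc d)) =
          qfac p L / (qfac p (Suc j) * qfac p d) + p ^ Suc d * (qfac p L / (qfac p j * qfac p (Suc d)))"
        using nz unfolding qfac_Suc d by (simp add: divide_simps) (simp add: algebra_simps power_add)
      have e: "Suc L - Suc j = Suc d" "L - Suc j = d" "L - j = Suc d"
        using d by auto
      have "b (Suc L) (Suc j) = (- z) ^ Suc j * (p powi tri (int j) * p ^ j) *
          (qfac p L / (qfac p (Suc j) * qfac p d) + p ^ Suc d * (qfac p L / (qfac p j * qfac p (Suc d))))"
        unfolding b_def e pw key using j by simp
      also have "\<dots> = b L (Suc j) - z * (p ^ j * p ^ Suc d) * b L j"
        unfolding b_def e pw using d by (simp add: algebra_simps)
      also have "p ^ j * p ^ Suc d = p ^ L"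
        by (simp add: d power_add)
      finally show ?thesis .
    qed
  qed
  have "(\<Sum>j\<le>Suc L. b (Suc L) j) = 1 + (\<Sum>j\<le>L. b L (Suc j) - z * p ^ L * b L j)"
    by (simp add: sum.atMost_Suc_shift b0 b_Suc del: sum.atMost_Suc)
  also have "\<dots> = (\<Sum>j\<le>Suc L. b L j) - z * p ^ L * (\<Sum>j\<le>L. b L j)"
    by (simp add: sum.atMost_Suc_shift b0 sum_subtractf sum_distrib_left del: sum.atMost_Suc)
  also have "(\<Sum>j\<le>Suc L. b L j) = (\<Sum>j\<le>L. b L j)"
    by (simp add: b_def)
  also have "(\<Sum>j\<le>L. b L j) = (\<Prod>k<L. 1 - z * p ^ k)"
    unfolding Suc.IH by (simp add: b_def)
  finally show ?case
    by (simp add: b_def algebra_simps del: sum.atMost_Suc)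
qed

text \<open>
  The finite form of the triple product. The \<open>2 M\<close> factors form one geometric sequence of the
  type \<open>1 - z p\<^sup>k\<close> with \<open>z = x / p\<^sup>M\<close>, once a monomial is pulled out of each factor
  \<open>1 - p\<^sup>n\<^sup>+\<^sup>1 / x\<close>; the Gaussian binomial theorem expands it.
\<close>

lemma jtheta_partial_product:
  fixes p x :: complex
  assumes p: "p \<noteq> 0" "norm p < 1" and x: "x \<noteq> 0"
  shows "(\<Prod>n<M. (1 - x * p ^ n) * (1 - p ^ (n + 1) / x)) =
    (\<Sum>n=-int M..int M. (- x) powi n * p powi tri n *
       (qfac p (2 * M) / (qfac p (nat (int M + n)) * qfac p (nat (int M - n)))))" (is "_ = ?S")
proof -
  let ?P = "(\<Prod>n<M. (1 - x * p ^ n) * (1 - p ^ (n + 1) / x))"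
  \<comment> \<open>The product of the monomials that turn \<open>1 - p\<^sup>n\<^sup>+\<^sup>1 / x\<close> into \<open>1 - x / p\<^sup>n\<^sup>+\<^sup>1\<close>.\<close>
  define D where "D = (- x) powi int M * p powi (- tri (int M + 1))"
  have D: "(\<Prod>n<M. - x / p ^ (n + 1)) = D"
    unfolding D_def
  proof (induction M)
    case (Suc M)
    have "tri (int (Suc M) + 1) = tri (int M + 1) + int (Suc M)"
      using tri_Suc[of "int M + 1"] by simp
    moreover have "p powi (- (a + b)) = p powi (- a) / p powi b" for a b
      unfolding power_int_minus using p(1) by (simp add: power_int_add field_simps)
    ultimately have t: "p powi (- tri (int (Suc M) + 1)) = p powi (- tri (int M + 1)) / p ^ Suc M"
      by (simp only: power_int_of_nat)
    show ?case
      unfolding prod.lessThan_Suc Suc.IH t by (simp only: power_int_of_nat power_Suc) simp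
  qed simp
  have D0: "D \<noteq> 0"
    using p(1) x by (simp add: D_def)
  have split: "(\<Prod>k<M + n. 1 - (x / p ^ M) * p ^ k) =
      (\<Prod>k<M. 1 - (x / p ^ M) * p ^ k) * (\<Prod>k<n. 1 - (x / p ^ M) * p ^ (k + M))" for n
    by (induction n) (simp_all add: ac_simps)
  have "(\<Prod>k<2 * M. 1 - (x / p ^ M) * p ^ k) =
      (\<Prod>k<M. 1 - (x / p ^ M) * p ^ k) * (\<Prod>k<M. 1 - (x / p ^ M) * p ^ (k + M))"
    using split[of M] by (simp only: mult_2)
  also have "(\<Prod>k<M. 1 - (x / p ^ M) * p ^ (k + M)) = (\<Prod>k<M. 1 - x * p ^ k)"
    using p(1) by (simp add: power_add)
  also have "(\<Prod>k<M. 1 - (x / p ^ M) * p ^ k) = (\<Prod>k<M. 1 - x / p ^ (k + 1))"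
  proof -
    have "(\<Prod>k<M. 1 - (x / p ^ M) * p ^ k) = (\<Prod>k<M. 1 - (x / p ^ M) * p ^ (M - Suc k))"
      by (rule prod.nat_diff_reindex[symmetric])
    also have "\<dots> = (\<Prod>k<M. 1 - x / p ^ (k + 1))"
      using p(1) by (intro prod.cong refl) (simp add: power_diff)
    finally show ?thesis .
  qed
  also have "\<dots> = (\<Prod>k<M. (- x / p ^ (k + 1)) * (1 - p ^ (k + 1) / x))"
    using p(1) x by (intro prod.cong refl) (simp add: field_simps)
  also have "\<dots> = D * (\<Prod>k<M. 1 - p ^ (k + 1) / x)"
    unfolding prod.distrib D ..
  finally have "D * ?P = (\<Prod>k<2 * M. 1 - (x / p ^ M) * p ^ k)"
    by (simp add: prod.distrib mult_ac)
  also have "\<dots> = (\<Sum>j\<le>2 * M. (- (x / p ^ M)) ^ j * p powi tri (int j) *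
      (qfac p (2 * M) / (qfac p j * qfac p (2 * M - j))))"
    by (rule gauss_binomial_theorem[OF p])
  also have "\<dots> = (\<Sum>n=-int M..int M. D * ((- x) powi n * p powi tri n *
       (qfac p (2 * M) / (qfac p (nat (int M + n)) * qfac p (nat (int M - n))))))"
  proof (rule sum.reindex_bij_witness[of _ "\<lambda>n. nat (int M + n)" "\<lambda>j. int j - int M"])
    fix j assume j: "j \<in> {..2 * M}"
    define n where "n = int j - int M"
    have j': "int j = int M + n" by (simp add: n_def)
    have q: "nat (int M + n) = j" "nat (int M - n) = 2 * M - j"
      using j by (auto simp: n_def)
    have t: "tri (int j) - int M * int j = tri n - tri (int M + 1)"
      using two_tri[of "int j"] two_tri[of n] two_tri[of "int M + 1"]
      by (simp add: j' algebra_simps)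
    have "(- (x / p ^ M)) ^ j * p powi tri (int j) = (- x) powi (int j) * (p powi tri (int j) / p powi (int M * int j))"
      using p(1) by (simp add: power_int_mult power_divide power_minus' flip: power_mult)
    also have "p powi tri (int j) / p powi (int M * int j) = p powi (tri n - tri (int M + 1))"
      using p(1) by (simp flip: power_int_diff t)
    also have "(- x) powi (int j) * p powi (tri n - tri (int M + 1)) = D * ((- x) powi n * p powi tri n)"
      using p(1) x by (simp add: D_def j' power_int_add power_int_diff power_int_minus field_simps)
    finally show "D * ((- x) powi (int j - int M) * p powi tri (int j - int M) *
         (qfac p (2 * M) / (qfac p (nat (int M + (int j - int M))) * qfac p (nat (int M - (int j - int M)))))) =
        (- (x / p ^ M)) ^ j * p powi tri (int j) * (qfac p (2 * M) / (qfac p j * qfac p (2 * M - j)))"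
      unfolding n_def[symmetric] q by simp
  qed auto
  finally have "D * ?P = D * ?S"
    by (simp only: sum_distrib_left)
  then show ?thesis
    using D0 by simp
qed

text \<open>
  The two halves of the series have the same shape, since \<open>n \<mapsto> - n\<close> replaces \<open>x\<close> by \<open>p / x\<close>;
  on each half the ratio of consecutive terms tends to 0.
\<close>

lemma theta_series_abs_summable:
  fixes p x :: complex
  assumes p: "p \<noteq> 0" "norm p < 1" and x: "x \<noteq> 0"
  shows "(\<lambda>n. x powi n * p powi tri n) abs_summable_on (UNIV :: int set)"
proof -
  have nat_case: "summable (\<lambda>k. norm (t ^ k * p powi tri (int k)))" for t :: complex
  proof -
    have step: "norm (t ^ Suc k * p powi tri (int (Suc k))) = norm (t * p ^ k) * norm (t ^ k * p powi tri (int k))" for k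
      using p(1) tri_Suc[of "int k"] by (simp add: power_int_add norm_mult add.commute)
    have "(\<lambda>k. norm (t * p ^ k)) \<longlonglongrightarrow> norm (t * 0)"
      by (intro tendsto_intros LIMSEQ_power_zero p)
    then have "eventually (\<lambda>k. norm (t * p ^ k) < 1 / 2) sequentially"
      by (rule order_tendstoD) simp
    then obtain K where K: "\<And>k. k \<ge> K \<Longrightarrow> norm (t * p ^ k) < 1 / 2"
      by (auto simp: eventually_sequentially)
    show ?thesis
    proof (rule summable_ratio_test[of "1 / 2" K])
      fix k assume "K \<le> k"
      then show "norm (norm (t ^ Suc k * p powi tri (int (Suc k)))) \<le> 1 / 2 * norm (norm (t ^ k * p powi tri (int k)))"
        unfolding real_norm_def abs_norm_cancel unfolding step using K[of k] by (intro mult_right_mono) auto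
    qed simp
  qed
  have "(\<lambda>k. x powi int k * p powi tri (int k)) abs_summable_on (UNIV :: nat set)"
    using nat_case[of x] by (simp add: abs_summable_on_nat_iff')
  then have 1: "(\<lambda>n. x powi n * p powi tri n) abs_summable_on {0..}"
    by (subst abs_summable_on_reindex_bij_betw[symmetric, of int UNIV])
       (auto simp: bij_betw_def image_iff intro: exI[of _ "nat _"] zero_le_imp_eq_int)
  have "(\<lambda>k. x powi (- int k) * p powi tri (- int k)) abs_summable_on (UNIV :: nat set)"
  proof -
    have "x powi (- int k) * p powi tri (- int k) = (p / x) ^ k * p powi tri (int k)" for k
      using p(1) x by (simp add: tri_uminus power_int_add power_int_minus power_divide field_simps)
    then show ?thesis
      using nat_case[of "p / x"] by (simp add: abs_summable_on_nat_iff')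
  qed
  then have 2: "(\<lambda>n. x powi n * p powi tri n) abs_summable_on {..0}"
    by (subst abs_summable_on_reindex_bij_betw[symmetric, of "\<lambda>k. - int k" UNIV])
       (auto simp: bij_betw_def inj_on_def image_iff intro: nonpos_int_cases)
  have "{0..} \<union> {..0} = (UNIV :: int set)" by auto
  then show ?thesis
    using abs_summable_on_union[OF 1 2] by simp
qed

text \<open>
  The limit \<open>M \<rightarrow> \<infinity>\<close> of the finite form by dominated convergence: the Gaussian binomial coefficients
  are bounded and tend to \<open>1 / L\<close>, where \<open>L = (p; p)\<^sub>\<infinity>\<close>. The constant stays
  abstract because the formulas derived from the series are homogeneous in it.
\<close>

lemma jacobi_triple_product:
  fixes p :: complex
  assumes p: "p \<noteq> 0" "norm p < 1"
  obtains L where "L \<noteq> 0"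
    "\<And>x. x \<noteq> 0 \<Longrightarrow> L * jtheta x p = infsetsum (\<lambda>n. (- x) powi n * p powi tri n) (UNIV :: int set)"
proof -
  obtain L where L: "L \<noteq> 0" "qfac p \<longlonglongrightarrow> L"
    using qfac_LIMSEQ[OF p(2)] .
  have "Bseq (qfac p)"
    using L(2) by (auto intro: convergent_imp_Bseq convergentI)
  then obtain K1 where K1: "K1 > 0" "\<And>n. norm (qfac p n) \<le> K1"
    by (auto elim: BseqE)
  have "(\<lambda>n. inverse (qfac p n)) \<longlonglongrightarrow> inverse L"
    by (intro tendsto_intros L)
  then have "Bseq (\<lambda>n. inverse (qfac p n))"
    by (auto intro: convergent_imp_Bseq convergentI)
  then obtain K2 where K2: "K2 > 0" "\<And>n. norm (inverse (qfac p n)) \<le> K2"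
    by (auto elim: BseqE)
  show thesis
  proof
    fix x :: complex assume x: "x \<noteq> 0"
    define c where "c n = (- x) powi n * p powi tri n" for n
    define Q where "Q M n = qfac p (2 * M) / (qfac p (nat (int M + n)) * qfac p (nat (int M - n)))" for M n
    \<comment> \<open>The partial product of index \<open>M\<close> as a series over all integers.\<close>
    define s where "s M n = (if n \<in> {-int M..int M} then c n * Q M n else 0)" for M n
    have c: "c abs_summable_on UNIV"
      unfolding c_def using theta_series_abs_summable[OF p, of "- x"] x by simp
    have Qb: "norm (Q M n) \<le> K1 * (K2 * K2)" for M n
      unfolding Q_def divide_inverse inverse_mult_distrib norm_mult
      using K1 K2 by (intro mult_mono) auto
    have "(\<lambda>M. Q M n) \<longlonglongrightarrow> L / (L * L)" for n
    proof -
      have "filterlim (\<lambda>M::nat. 2 * M) sequentially sequentially"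
        by (rule filterlim_subseq) (simp add: strict_mono_def)
      moreover have shift: "filterlim (\<lambda>M. nat (int M + k)) sequentially sequentially" for k
        unfolding filterlim_at_top eventually_sequentially
      proof
        fix Z
        show "\<exists>N. \<forall>n\<ge>N. Z \<le> nat (int n + k)"
          by (rule exI[of _ "nat (int Z - k)"]) auto
      qed
      moreover have "filterlim (\<lambda>M. nat (int M - n)) sequentially sequentially"
        using shift[of "- n"] by simp
      ultimately show ?thesis
        unfolding Q_def using L(1)
        by (intro tendsto_divide tendsto_mult filterlim_compose[OF L(2)]) auto
    qed
    then have lim: "(\<lambda>M. s M n) \<longlonglongrightarrow> c n * (L / (L * L))" for n
    proof -
      have "eventually (\<lambda>M. c n * Q M n = s M n) sequentially"
        using eventually_ge_at_top[of "nat \<bar>n\<bar>"]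
        by eventually_elim (auto simp: s_def)
      moreover have "(\<lambda>M. c n * Q M n) \<longlonglongrightarrow> c n * (L / (L * L))"
        by (intro tendsto_intros) fact
      ultimately show ?thesis
        by (rule Lim_transform_eventually[rotated])
    qed
    have w: "(\<lambda>n. norm (c n) * (K1 * (K2 * K2))) abs_summable_on UNIV"
      using c by (intro abs_summable_on_cmult_left) auto
    have sb: "norm (s M n) \<le> norm (c n) * (K1 * (K2 * K2))" for M n
    proof (cases "n \<in> {-int M..int M}")
      case True
      then show ?thesis
        using mult_left_mono[OF Qb[of M n] norm_ge_zero[of "c n"]] by (simp add: s_def norm_mult)
    next
      case False
      have "0 \<le> K1 * (K2 * K2)" using K1(1) K2(1) by simp
      then show ?thesis
        unfolding s_def if_not_P[OF False] by simp
    qed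
    have "(\<lambda>M. infsetsum (s M) UNIV) \<longlonglongrightarrow> infsetsum (\<lambda>n. c n * (L / (L * L))) UNIV"
      unfolding infsetsum_def
      by (rule integral_dominated_convergence[where w = "\<lambda>n. norm (c n) * (K1 * (K2 * K2))"])
         (use w lim sb in \<open>simp_all add: abs_summable_on_def\<close>)
    moreover have "infsetsum (s M) UNIV = (\<Prod>n<M. (1 - x * p ^ n) * (1 - p ^ (n + 1) / x))" for M
    proof -
      have "infsetsum (s M) UNIV = infsetsum (\<lambda>n. c n * Q M n) {-int M..int M}"
        by (rule infsetsum_cong_neutral) (auto simp: s_def)
      also have "\<dots> = (\<Sum>n=-int M..int M. c n * Q M n)"
        by simp
      also have "\<dots> = (\<Prod>n<M. (1 - x * p ^ n) * (1 - p ^ (n + 1) / x))"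
        unfolding c_def Q_def by (rule jtheta_partial_product[OF p x, symmetric])
      finally show ?thesis .
    qed
    ultimately have "(\<lambda>M. \<Prod>n<M. (1 - x * p ^ n) * (1 - p ^ (n + 1) / x))
        \<longlonglongrightarrow> infsetsum (\<lambda>n. c n * (L / (L * L))) UNIV"
      by (simp only:)
    then have "jtheta x p = infsetsum (\<lambda>n. c n * (L / (L * L))) UNIV"
      by (rule LIMSEQ_unique[OF jtheta_LIMSEQ[OF p(2) x]])
    also have "\<dots> = infsetsum c UNIV * (L / (L * L))"
      using c by (intro infsetsum_cmult_left)
    finally show "L * jtheta x p = infsetsum (\<lambda>n. (- x) powi n * p powi tri n) UNIV"
      using L(1) by (simp add: c_def[abs_def])
  qed fact
qed

section \<open>Products of two theta functions as determinants\<close>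

lemma jtheta_p_0:
  assumes "x \<noteq> 0"
  shows "jtheta x 0 = 1 - x"
proof -
  have "(\<Prod>n<Suc M. (1 - x * 0 ^ n) * (1 - 0 ^ (n + 1) / x)) = 1 - x" for M
    by (induction M) auto
  then have "(\<lambda>M. \<Prod>n<Suc M. (1 - x * 0 ^ n) * (1 - 0 ^ (n + 1) / x)) \<longlonglongrightarrow> 1 - x"
    by (simp only: tendsto_const)
  then show ?thesis
    using LIMSEQ_unique[OF LIMSEQ_Suc[OF jtheta_LIMSEQ[of 0 x]]] assms by simp
qed

text \<open>
  The product is a double series over \<open>(n, m)\<close> whose monomial is \<open>x\<^sup>n\<^sup>+\<^sup>m y\<^sup>n\<^sup>-\<^sup>m\<close>. The numbers \<open>n + m\<close> and
  \<open>n - m\<close> have the same parity and are otherwise free, and the exponent of \<open>p\<close> is a sum of a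
  function of \<open>n + m\<close> and a function of \<open>n - m\<close>. So the even and the odd part are each a product
  of a series in \<open>x\<close> and a series in \<open>y\<close>.
\<close>

lemma theta_series_product:
  fixes p x y :: complex
  assumes p: "p \<noteq> 0" "norm p < 1" and x: "x \<noteq> 0" and y: "y \<noteq> 0"
  defines "H \<equiv> \<lambda>z. infsetsum (\<lambda>n. (- z) powi n * p powi tri n) (UNIV :: int set)"
    and "Phi \<equiv> \<lambda>z. infsetsum (\<lambda>n. z powi n * (p\<^sup>2) powi tri n) (UNIV :: int set)"
  shows "H (x * y) * H (x / y) = Phi (x\<^sup>2) * Phi (p * y\<^sup>2) - x / y * Phi (p * x\<^sup>2) * Phi (y\<^sup>2)"
proof -
  define A B where "A = - (x * y)" and "B = - (x / y)"
  have AB: "A \<noteq> 0" "B \<noteq> 0" "A * B = x\<^sup>2" "A / B = y\<^sup>2"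
    using x y by (auto simp: A_def B_def power2_eq_square)
  define g where "g = (\<lambda>(n, m). (A powi n * p powi tri n) * (B powi m * p powi tri m))"
  define f where "f z n = z powi n * (p\<^sup>2) powi tri n" for z n
  have pa: "p powi i * p powi j = p powi (i + j)" for i j
    using p(1) by (simp add: power_int_add)
  have pw: "p powi (2 * i) = (p\<^sup>2) powi i" for i
    by (simp add: power_int_mult)
  have p2: "p\<^sup>2 \<noteq> 0" "norm (p\<^sup>2) < 1"
    using p by (simp_all add: norm_power power_less_one_iff)
  have f_summable: "f z abs_summable_on UNIV" if "z \<noteq> 0" for z
    unfolding f_def using theta_series_abs_summable[OF p2 that] .
  have fxy: "infsetsum (\<lambda>(s, d). f z s * f w d) (UNIV \<times> UNIV) = Phi z * Phi w" if "z \<noteq> 0" "w \<noteq> 0" for z w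
    unfolding Phi_def f_def[symmetric] by (intro infsetsum_product f_summable that) auto
  have g_summable: "g abs_summable_on UNIV"
    unfolding g_def UNIV_Times_UNIV[symmetric]
    by (intro abs_summable_on_product theta_series_abs_summable p AB) auto
  have "H (x * y) * H (x / y) = infsetsum g UNIV"
    unfolding g_def UNIV_Times_UNIV[symmetric] H_def A_def B_def
    by (intro infsetsum_product[symmetric] theta_series_abs_summable p) (use x y in auto)
  also have "(UNIV :: (int \<times> int) set) = {(n, m). even (n + m)} \<union> {(n, m). odd (n + m)}"
    by auto
  also have "infsetsum g \<dots> = infsetsum g {(n, m). even (n + m)} + infsetsum g {(n, m). odd (n + m)}"
    by (intro infsetsum_Un_disjoint abs_summable_on_subset[OF g_summable]) auto
  also have "infsetsum g {(n, m). even (n + m)} = infsetsum (\<lambda>(s, d). g (s + d, s - d)) (UNIV \<times> UNIV)"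
  proof -
    have "bij_betw (\<lambda>(s, d). (s + d, s - d)) (UNIV \<times> UNIV) ({(n, m). even (n + m)} :: (int \<times> int) set)"
      by (rule bij_betw_byWitness[where f' = "\<lambda>(n, m). ((n + m) div 2, (n - m) div 2)"])
         (auto elim!: evenE, presburger+)
    from infsetsum_reindex_bij_betw[OF this, of g, symmetric] show ?thesis
      by (simp add: case_prod_unfold)
  qed
  also have "(\<lambda>(s, d). g (s + d, s - d)) = (\<lambda>(s, d). f (x\<^sup>2) s * f (p * y\<^sup>2) d)"
  proof (intro ext, clarify)
    fix s d :: int
    have "tri (s + d) + tri (s - d) = 2 * tri s + (2 * tri d + d)"
      using two_tri[of "s + d"] two_tri[of "s - d"] two_tri[of s] two_tri[of d]
      by (simp add: algebra_simps)
    then have e: "p powi tri (s + d) * p powi tri (s - d) = (p\<^sup>2) powi tri s * ((p\<^sup>2) powi tri d * p powi d)"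
      by (simp only: pa) (simp only: pa[symmetric] pw mult.assoc)
    have "A powi (s + d) * B powi (s - d) = (A * B) powi s * (A / B) powi d"
      using AB(1,2) by (simp add: power_int_add power_int_diff power_int_mult_distrib power_int_divide_distrib)
    then have "A powi (s + d) * B powi (s - d) = (x\<^sup>2) powi s * (y\<^sup>2) powi d"
      unfolding AB .
    moreover have "g (s + d, s - d) = (A powi (s + d) * B powi (s - d)) * (p powi tri (s + d) * p powi tri (s - d))"
      by (simp add: g_def)
    ultimately show "g (s + d, s - d) = f (x\<^sup>2) s * f (p * y\<^sup>2) d"
      unfolding e by (simp add: f_def power_int_mult_distrib)
  qed
  also have "infsetsum \<dots> (UNIV \<times> UNIV) = Phi (x\<^sup>2) * Phi (p * y\<^sup>2)"
    by (rule fxy) (use p x y in auto)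
  also have "infsetsum g {(n, m). odd (n + m)} = infsetsum (\<lambda>(s, d). g (s + d, s - d + 1)) (UNIV \<times> UNIV)"
  proof -
    have "bij_betw (\<lambda>(s, d). (s + d, s - d + 1)) (UNIV \<times> UNIV) ({(n, m). odd (n + m)} :: (int \<times> int) set)"
      by (rule bij_betw_byWitness[where f' = "\<lambda>(n, m). ((n + m - 1) div 2, (n - m + 1) div 2)"])
         (auto elim!: oddE, presburger+)
    from infsetsum_reindex_bij_betw[OF this, of g, symmetric] show ?thesis
      by (simp add: case_prod_unfold)
  qed
  also have "(\<lambda>(s, d). g (s + d, s - d + 1)) = (\<lambda>(s, d). B * (f (p * x\<^sup>2) s * f (y\<^sup>2) d))"
  proof (intro ext, clarify)
    fix s d :: int
    have "tri (s + d) + tri (s - d + 1) = (2 * tri s + s) + 2 * tri d"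
      using two_tri[of "s + d"] two_tri[of "s - d + 1"] two_tri[of s] two_tri[of d]
      by (simp add: algebra_simps)
    then have e: "p powi tri (s + d) * p powi tri (s - d + 1) = ((p\<^sup>2) powi tri s * p powi s) * (p\<^sup>2) powi tri d"
      by (simp only: pa) (simp only: pa[symmetric] pw mult.assoc)
    have "A powi (s + d) * B powi (s - d + 1) = B * ((A * B) powi s * (A / B) powi d)"
      using AB(1,2) by (simp add: power_int_add power_int_diff power_int_mult_distrib power_int_divide_distrib)
    then have "A powi (s + d) * B powi (s - d + 1) = B * ((x\<^sup>2) powi s * (y\<^sup>2) powi d)"
      unfolding AB .
    moreover have "g (s + d, s - d + 1) = (A powi (s + d) * B powi (s - d + 1)) * (p powi tri (s + d) * p powi tri (s - d + 1))"
      by (simp add: g_def)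
    ultimately show "g (s + d, s - d + 1) = B * (f (p * x\<^sup>2) s * f (y\<^sup>2) d)"
      unfolding e by (simp add: f_def power_int_mult_distrib)
  qed
  also have "infsetsum \<dots> (UNIV \<times> UNIV) = B * (Phi (p * x\<^sup>2) * Phi (y\<^sup>2))"
  proof -
    have "(\<lambda>(s, d). f (p * x\<^sup>2) s * f (y\<^sup>2) d) abs_summable_on (UNIV \<times> UNIV)"
      by (intro abs_summable_on_product f_summable) (use p x y in auto)
    then show ?thesis
      using fxy[of "p * x\<^sup>2" "y\<^sup>2"] p x y
      by (simp add: case_prod_unfold infsetsum_cmult_right)
  qed
  finally show ?thesis
    by (simp add: B_def)
qed

text \<open>
  This is Weierstrass's addition formula in structural form: the formula says that the left-hand
  sides satisfy the Pluecker relation of two by two minors. For \<open>p = 0\<close>, where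
  \<open>jtheta x 0 = 1 - x\<close>, the determinant can be written down directly.
\<close>

lemma jtheta_determinant:
  fixes p :: complex
  assumes p: "norm p < 1"
  obtains u v where
    "\<And>x y. x \<noteq> 0 \<Longrightarrow> y \<noteq> 0 \<Longrightarrow> jtheta (x * y) p * jtheta (x / y) p / x = u x * v y - v x * u y"
proof (cases "p = 0")
  case True
  show thesis
  proof (rule that[of "\<lambda>x. x + 1 / x" "\<lambda>_. 1"])
    fix x y :: complex assume "x \<noteq> 0" "y \<noteq> 0"
    then show "jtheta (x * y) p * jtheta (x / y) p / x = (x + 1 / x) * 1 - 1 * (y + 1 / y)"
      unfolding True by (simp add: jtheta_p_0 field_simps)
  qed
next
  case False
  obtain L where L: "L \<noteq> 0"
    "\<And>x. x \<noteq> 0 \<Longrightarrow> L * jtheta x p = infsetsum (\<lambda>n. (- x) powi n * p powi tri n) UNIV"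
    using jacobi_triple_product[OF False p] by blast
  define Phi where "Phi z = infsetsum (\<lambda>n. z powi n * (p\<^sup>2) powi tri n) UNIV" for z
  show thesis
  proof (rule that[of "\<lambda>x. Phi (x\<^sup>2) / x / L" "\<lambda>x. Phi (p * x\<^sup>2) / L"])
    fix x y :: complex assume xy: "x \<noteq> 0" "y \<noteq> 0"
    have "(L * jtheta (x * y) p) * (L * jtheta (x / y) p) =
        Phi (x\<^sup>2) * Phi (p * y\<^sup>2) - x / y * Phi (p * x\<^sup>2) * Phi (y\<^sup>2)"
      using theta_series_product[OF False p xy] xy by (simp only: L(2) Phi_def mult_eq_0_iff divide_eq_0_iff simp_thms)
    then have "(L * L) * (jtheta (x * y) p * jtheta (x / y) p) =
        Phi (x\<^sup>2) * Phi (p * y\<^sup>2) - x / y * Phi (p * x\<^sup>2) * Phi (y\<^sup>2)"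
      by (simp only: mult_ac)
    then have "jtheta (x * y) p * jtheta (x / y) p =
        (Phi (x\<^sup>2) * Phi (p * y\<^sup>2) - x / y * Phi (p * x\<^sup>2) * Phi (y\<^sup>2)) / (L * L)"
      using L(1) by (metis mult_eq_0_iff nonzero_mult_div_cancel_left)
    then show "jtheta (x * y) p * jtheta (x / y) p / x =
        Phi (x\<^sup>2) / x / L * (Phi (p * y\<^sup>2) / L) - Phi (p * x\<^sup>2) / L * (Phi (y\<^sup>2) / y / L)"
      using xy L(1) by (simp add: field_simps)
  qed
qed

section \<open>Lagrange interpolation\<close>

text \<open>
  A minor \<open>w a x\<close> is linear in the vector \<open>(u x, v x)\<close>, so a product of \<open>N\<close> of them is a binary form of
  degree \<open>N\<close> in that vector and is determined by its values at \<open>N + 1\<close> pairwise independent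
  points. The induction adds one factor and one node: the new factor is interpolated linearly
  between the old node \<open>z k\<close> and the new node, and the contributions to the new node
  are collected by the induction hypothesis, applied at the new node.
\<close>

lemma determinant_product_interpolation:
  fixes u v :: "'b \<Rightarrow> 'a :: field" and a z :: "nat \<Rightarrow> 'b" and x :: 'b
  defines "w \<equiv> \<lambda>x y. u x * v y - v x * u y"
  assumes "\<And>j k. j \<le> N \<Longrightarrow> k \<le> N \<Longrightarrow> j \<noteq> k \<Longrightarrow> w (z j) (z k) \<noteq> 0"
  shows "(\<Prod>i<N. w (a i) x) =
    (\<Sum>k\<le>N. (\<Prod>i<N. w (a i) (z k)) * (\<Prod>j\<in>{..N} - {k}. w (z j) x / w (z j) (z k)))"
  using assms(2)
proof (induction N arbitrary: x)
  case 0
  then show ?case by simp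
next
  case (Suc N)
  define F where "F y = (\<Prod>i<N. w (a i) y)" for y
  define l where "l k y = (\<Prod>j\<in>{..N} - {k}. w (z j) y / w (z j) (z k))" for k y
  define W where "W y = (\<Prod>j\<le>N. w (z j) y)" for y
  let ?b = "a N" and ?c = "z (Suc N)"
  have IH: "F y = (\<Sum>k\<le>N. F (z k) * l k y)" for y
    unfolding F_def l_def by (rule Suc.IH) (use Suc.prems in auto)
  have nz: "w (z k) ?c \<noteq> 0" "w ?c (z k) \<noteq> 0" if "k \<le> N" for k
    using Suc.prems[of k "Suc N"] Suc.prems[of "Suc N" k] that by auto
  have anti: "w s t = - w t s" for s t
    by (simp add: w_def)
  \<comment> \<open>Linear interpolation of the new factor, which is the Pluecker relation.\<close>
  have two_points: "w ?b x = w ?b (z k) * (w ?c x / w ?c (z k)) + w ?b ?c * (w (z k) x / w (z k) ?c)"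
    if "k \<le> N" for k
    using nz[OF that] anti[of ?c "z k"]
    by (simp add: divide_simps) (simp add: w_def algebra_simps)
  have l_W: "l k y * w (z k) y = W y / (\<Prod>j\<in>{..N} - {k}. w (z j) (z k))" if "k \<le> N" for k y
    using that prod.remove[of "{..N}" k "\<lambda>j. w (z j) y"] by (simp add: l_def W_def prod_dividef)
  have W_nz: "W ?c \<noteq> 0"
    using nz by (simp add: W_def)
  \<comment> \<open>The contributions to the new node.\<close>
  have last: "(\<Sum>k\<le>N. F (z k) * l k x * (w (z k) x / w (z k) ?c)) = F ?c * (W x / W ?c)"
  proof -
    have "F (z k) * l k x * (w (z k) x / w (z k) ?c) = F (z k) * l k ?c * (W x / W ?c)" if "k \<le> N" for k
    proof -
      have "l k x * w (z k) x * W ?c = l k ?c * w (z k) ?c * W x"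
        by (simp add: l_W[OF that])
      then show ?thesis
        using nz(1)[OF that] W_nz by (simp add: field_simps)
    qed
    then have "(\<Sum>k\<le>N. F (z k) * l k x * (w (z k) x / w (z k) ?c)) =
        (\<Sum>k\<le>N. F (z k) * l k ?c) * (W x / W ?c)"
      unfolding sum_distrib_right by (intro sum.cong refl) simp
    then show ?thesis
      by (simp only: IH[symmetric])
  qed
  have rest: "(\<Prod>j\<in>{..Suc N} - {k}. w (z j) x / w (z j) (z k)) = l k x * (w ?c x / w ?c (z k))"
    if "k \<le> N" for k
  proof -
    have "{..Suc N} - {k} = insert (Suc N) ({..N} - {k})"
      using that by auto
    then show ?thesis
      by (simp add: l_def)
  qed
  have "(\<Prod>i<Suc N. w (a i) x) = F x * w ?b x"
    by (simp add: F_def)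
  also have "\<dots> = (\<Sum>k\<le>N. F (z k) * l k x * w ?b x)"
    by (simp add: IH[of x] sum_distrib_right)
  also have "\<dots> = (\<Sum>k\<le>N. F (z k) * w ?b (z k) * (l k x * (w ?c x / w ?c (z k))) +
      w ?b ?c * (F (z k) * l k x * (w (z k) x / w (z k) ?c)))"
    by (intro sum.cong refl) (subst two_points, auto simp: algebra_simps)
  also have "\<dots> = (\<Sum>k\<le>N. F (z k) * w ?b (z k) * (l k x * (w ?c x / w ?c (z k)))) +
      F ?c * w ?b ?c * (W x / W ?c)"
    unfolding sum.distrib sum_distrib_left[symmetric] last by (simp add: mult_ac)
  also have "W x / W ?c = (\<Prod>j\<in>{..Suc N} - {Suc N}. w (z j) x / w (z j) ?c)"
    by (simp add: W_def prod_dividef atMost_Suc)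
  also have "(\<Sum>k\<le>N. F (z k) * w ?b (z k) * (l k x * (w ?c x / w ?c (z k)))) =
      (\<Sum>k\<le>N. F (z k) * w ?b (z k) * (\<Prod>j\<in>{..Suc N} - {k}. w (z j) x / w (z j) (z k)))"
    by (intro sum.cong refl) (simp add: rest)
  finally show ?case
    by (simp add: F_def del: prod.atMost_Suc)
qed

text \<open>
  The abstract formula for the minors of \<open>jtheta_determinant\<close>. Their denominators cancel: \<open>w (a i) x\<close> and
  \<open>w (a i) (z k)\<close> both have \<open>a i\<close>, and \<open>w (z j) x\<close> and \<open>w (z j) (z k)\<close> both have \<open>z j\<close>.
\<close>

lemma theta_interpolation:
  fixes a :: "'i \<Rightarrow> complex"
  assumes p: "norm p < 1" and I: "finite I" "card I = N"
    and x: "x \<noteq> 0" and a: "\<And>i. i \<in> I \<Longrightarrow> a i \<noteq> 0" and z: "\<And>k. z k \<noteq> 0"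
    and nodes: "\<And>j k. j \<le> N \<Longrightarrow> k \<le> N \<Longrightarrow> j \<noteq> k \<Longrightarrow> jtheta (z j * z k) p * jtheta (z j / z k) p \<noteq> 0"
  shows "(\<Prod>i\<in>I. jtheta (a i * x) p * jtheta (a i / x) p) =
    (\<Sum>k\<le>N. (\<Prod>i\<in>I. jtheta (a i * z k) p * jtheta (a i / z k) p) *
       (\<Prod>j\<in>{..N} - {k}. jtheta (z j * x) p * jtheta (z j / x) p /
          (jtheta (z j * z k) p * jtheta (z j / z k) p)))"
proof -
  obtain u v where uv: "\<And>x y. x \<noteq> 0 \<Longrightarrow> y \<noteq> 0 \<Longrightarrow>
      jtheta (x * y) p * jtheta (x / y) p / x = u x * v y - v x * u y"
    using jtheta_determinant[OF p] by blast
  define w where "w x y = u x * v y - v x * u y" for x y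
  have w: "w s t = jtheta (s * t) p * jtheta (s / t) p / s" if "s \<noteq> 0" "t \<noteq> 0" for s t
    using uv[OF that] by (simp add: w_def)
  obtain e where e: "bij_betw e {..<N} I"
    using ex_bij_betw_nat_finite[OF I(1)] I(2) by (auto simp: atLeast0LessThan)
  have w_prod: "(\<Prod>i<N. w (a (e i)) y) = (\<Prod>i\<in>I. jtheta (a i * y) p * jtheta (a i / y) p) / (\<Prod>i\<in>I. a i)"
    if "y \<noteq> 0" for y
  proof -
    have "(\<Prod>i<N. w (a (e i)) y) = (\<Prod>i\<in>I. w (a i) y)"
      by (rule prod.reindex_bij_betw[OF e])
    also have "\<dots> = (\<Prod>i\<in>I. jtheta (a i * y) p * jtheta (a i / y) p / a i)"
      by (intro prod.cong refl w a that)
    finally show ?thesis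
      by (simp add: prod_dividef)
  qed
  have "(\<Prod>i<N. w (a (e i)) x) =
      (\<Sum>k\<le>N. (\<Prod>i<N. w (a (e i)) (z k)) * (\<Prod>j\<in>{..N} - {k}. w (z j) x / w (z j) (z k)))"
    unfolding w_def
    by (rule determinant_product_interpolation) (use nodes z w in \<open>auto simp flip: w_def\<close>)
  also have "\<dots> = (\<Sum>k\<le>N. (\<Prod>i\<in>I. jtheta (a i * z k) p * jtheta (a i / z k) p) *
       (\<Prod>j\<in>{..N} - {k}. jtheta (z j * x) p * jtheta (z j / x) p /
          (jtheta (z j * z k) p * jtheta (z j / z k) p))) / (\<Prod>i\<in>I. a i)"
    unfolding sum_divide_distrib
    by (intro sum.cong refl) (simp add: w_prod z w x)
  finally show ?thesis
    using a I(1) by (simp add: w_prod[OF x])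
qed

section \<open>Theta shifted factorials\<close>

lemma theta_fact_0 [simp]: "theta_fact y q p 0 = 1"
  by (simp add: theta_fact_def)

lemma theta_fact_Suc: "theta_fact y q p (Suc n) = theta_fact y q p n * jtheta (y * q ^ n) p"
  by (simp add: theta_fact_def)

lemma theta_fact_add:
  "theta_fact y q p (m + n) = theta_fact y q p m * theta_fact (y * q ^ m) q p n"
  by (induction n) (simp_all add: theta_fact_Suc power_add mult_ac)

lemma theta_fact_Suc_shift: "theta_fact y q p (Suc n) = jtheta y p * theta_fact (y * q) q p n"
  using theta_fact_add[of y q p 1 n] by (simp add: theta_fact_Suc)

lemma theta_fact_nonzero_iff: "theta_fact y q p n \<noteq> 0 \<longleftrightarrow> (\<forall>k<n. jtheta (y * q ^ k) p \<noteq> 0)"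
  by (auto simp: theta_fact_def)

lemma theta_fact_nonzero_mono:
  assumes "theta_fact y q p n \<noteq> 0" "k \<le> n"
  shows "theta_fact y q p k \<noteq> 0"
  using assms by (auto simp: theta_fact_nonzero_iff)

lemma theta_fact_skip:
  assumes "k \<le> N"
  shows "(\<Prod>j\<in>{..N} - {k}. jtheta (y * q ^ j) p) =
    theta_fact y q p k * theta_fact (y * q ^ Suc k) q p (N - k)"
proof -
  have "{..N} - {k} = {..<k} \<union> {Suc k..N}"
    using assms by auto
  then have "(\<Prod>j\<in>{..N} - {k}. jtheta (y * q ^ j) p) =
      (\<Prod>j\<in>{..<k} \<union> {Suc k..N}. jtheta (y * q ^ j) p)"
    by (rule arg_cong)
  also have "\<dots> = theta_fact y q p k * (\<Prod>j=Suc k..N. jtheta (y * q ^ j) p)"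
    unfolding theta_fact_def by (rule prod.union_disjoint) auto
  also have "(\<Prod>j=Suc k..N. jtheta (y * q ^ j) p) = theta_fact (y * q ^ Suc k) q p (N - k)"
    unfolding theta_fact_def
    by (rule prod.reindex_bij_witness[of _ "\<lambda>j. j + Suc k" "\<lambda>j. j - Suc k"])
       (auto simp: mult.assoc simp del: power_Suc simp flip: power_add)
  finally show ?thesis .
qed

text \<open>
  The monomial in \<open>q\<close> that appears when all \<open>k\<close> factors of a shifted factorial are inverted.
\<close>

definition rev_factor :: "complex \<Rightarrow> nat \<Rightarrow> complex" where
  "rev_factor q k = (\<Prod>l<k. - (q ^ (l + 1)))"

lemma rev_factor_square: "rev_factor q k * rev_factor q k = q ^ k * q ^ (k * k)"
  by (induction k) (simp_all add: rev_factor_def power_add mult_ac)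

lemma theta_fact_reverse:
  assumes p: "norm p < 1" and q: "q \<noteq> 0" and y: "y \<noteq> 0"
  shows "theta_fact (q / y) q p k = rev_factor q k / y ^ k * theta_fact (y / q ^ k) q p k"
proof -
  have "theta_fact (q / y) q p k = (\<Prod>l<k. - (q ^ (l + 1)) / y * jtheta (y / q ^ Suc l) p)"
    unfolding theta_fact_def
  proof (intro prod.cong refl)
    fix l
    have "q / y * q ^ l = 1 / (y / q ^ Suc l)"
      by simp
    then show "jtheta (q / y * q ^ l) p = - (q ^ (l + 1)) / y * jtheta (y / q ^ Suc l) p"
      using jtheta_inverse[OF p, of "y / q ^ Suc l"] q y by simp
  qed
  also have "\<dots> = rev_factor q k / y ^ k * (\<Prod>l<k. jtheta (y / q ^ Suc l) p)"
    unfolding prod.distrib prod_dividef rev_factor_def by simp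
  also have "(\<Prod>l<k. jtheta (y / q ^ Suc l) p) = (\<Prod>l<k. jtheta (y / q ^ Suc (k - Suc l)) p)"
    by (rule prod.nat_diff_reindex[symmetric])
  also have "\<dots> = theta_fact (y / q ^ k) q p k"
    unfolding theta_fact_def
  proof (intro prod.cong refl)
    fix l assume "l \<in> {..<k}"
    then have "q ^ k = q ^ Suc (k - Suc l) * q ^ l"
      by (simp flip: power_add power_Suc)
    then show "jtheta (y / q ^ Suc (k - Suc l)) p = jtheta (y / q ^ k * q ^ l) p"
      using q by simp
  qed
  finally show ?thesis .
qed

section \<open>The summands of the series as interpolation terms\<close>

text \<open>
  The factors of the series that contain \<open>A\<close> measure how the interpolated function changes from
  \<open>C\<close> to the node \<open>C q\<^sup>n\<close>. For \<open>(A C)\<^sub>r\<close> the change shifts the range of the product upwards; for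
  \<open>(A / C)\<^sub>r\<close> it shifts it downwards, and the series has the inverted factors.
\<close>

lemma parameter_factor:
  assumes p: "norm p < 1" and q: "q \<noteq> 0" and C: "C \<noteq> 0" and A: "A \<noteq> 0"
    and nz: "theta_fact (A * C) q p r \<noteq> 0" "theta_fact (A / C) q p r \<noteq> 0"
      "theta_fact (A * C) q p n \<noteq> 0" "theta_fact (C * q / (A * q ^ r)) q p n \<noteq> 0"
  shows "theta_fact (A * C * q ^ r) q p n * theta_fact (C * q / A) q p n /
      (theta_fact (C * q / (A * q ^ r)) q p n * theta_fact (A * C) q p n) =
    (q ^ r) ^ n * (theta_fact (A * (C * q ^ n)) q p r * theta_fact (A / (C * q ^ n)) q p r) /
      (theta_fact (A * C) q p r * theta_fact (A / C) q p r)"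
proof -
  define y where "y = A / C"
  have y: "y \<noteq> 0" using A C by (simp add: y_def)
  have first: "theta_fact (A * C) q p r * theta_fact (A * C * q ^ r) q p n =
      theta_fact (A * C) q p n * theta_fact (A * (C * q ^ n)) q p r"
    using theta_fact_add[of "A * C" q p r n] theta_fact_add[of "A * C" q p n r]
    by (simp add: add.commute mult.assoc)
  have 1: "theta_fact (C * q / A) q p n = rev_factor q n / y ^ n * theta_fact (y / q ^ n) q p n"
    using theta_fact_reverse[OF p q y, of n] A C by (simp add: y_def mult.commute)
  have 2: "theta_fact (C * q / (A * q ^ r)) q p n =
      rev_factor q n / (y * q ^ r) ^ n * theta_fact (y / q ^ n * q ^ r) q p n"
    using theta_fact_reverse[OF p q, of "y * q ^ r" n] y q A C by (simp add: y_def mult.commute)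
  have 3: "theta_fact (y / q ^ n) q p n * theta_fact y q p r =
      theta_fact (y / q ^ n) q p r * theta_fact (y / q ^ n * q ^ r) q p n"
    using theta_fact_add[of "y / q ^ n" q p r n] theta_fact_add[of "y / q ^ n" q p n r] q
    by (simp add: add.commute)
  have "theta_fact (C * q / A) q p n * theta_fact y q p r =
      rev_factor q n / y ^ n * (theta_fact (y / q ^ n) q p n * theta_fact y q p r)"
    by (simp add: 1)
  also have "\<dots> = (q ^ r) ^ n * theta_fact (y / q ^ n) q p r * theta_fact (C * q / (A * q ^ r)) q p n"
    unfolding 2 3 using q y by (simp add: power_mult_distrib)
  finally have second: "theta_fact (C * q / A) q p n * theta_fact (A / C) q p r =
      (q ^ r) ^ n * theta_fact (A / (C * q ^ n)) q p r * theta_fact (C * q / (A * q ^ r)) q p n"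
    by (simp add: y_def)
  have div: "a * b / (c * d) = k * (e * f) / (g * h)"
    if "g * a = d * e" "b * h = k * f * c" "c \<noteq> 0" "d \<noteq> 0" "g \<noteq> 0" "h \<noteq> 0"
    for a b c d e f g h k :: complex
  proof -
    have "a = d * e / g" "b = k * f * c / h"
      using that by (simp_all add: eq_divide_eq mult.commute)
    then show ?thesis using that by simp
  qed
  show ?thesis
    by (rule div[OF first second nz(4,3,1,2)])
qed

text \<open>
  The quotient telescopes to \<open>\<theta>(y) / \<theta>(y q\<^sup>k)\<close>: the interpolation term of the node with index \<open>k\<close> lacks the
  factor \<open>\<theta>(y q\<^sup>k)\<close>, while the value of the series lacks \<open>\<theta>(y)\<close>.
\<close>

lemma argument_factor:
  assumes k: "k \<le> N" and nz: "theta_fact (y * q) q p N \<noteq> 0"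
  shows "theta_fact y q p k / theta_fact (y * q) q p k =
    (\<Prod>j\<in>{..N} - {k}. jtheta (y * q ^ j) p) / theta_fact (y * q) q p N"
proof -
  have "theta_fact (y * q) q p N = theta_fact (y * q) q p k * theta_fact (y * q ^ Suc k) q p (N - k)"
    using theta_fact_add[of "y * q" q p k "N - k"] k by (simp add: mult.assoc)
  then show ?thesis
    using nz by (simp add: theta_fact_skip[OF k])
qed

text \<open>
  With \<open>b = C\<^sup>2\<close>, the left-hand side is the very-well-poised factor of the series and the right-hand
  side contains theta at the products \<open>z j z k\<close> of the nodes. Both sides result from splitting the
  factorial of length \<open>k + N + 1\<close> in two ways.
\<close>

lemma base_factor:
  assumes k: "k \<le> N"
    and nz: "theta_fact b q p (Suc N) \<noteq> 0" "theta_fact (b * q ^ Suc N) q p N \<noteq> 0"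
  shows "jtheta (b * q ^ (2 * k)) p * theta_fact b q p k / (jtheta b p * theta_fact (b * q ^ Suc N) q p k) =
    theta_fact (b * q) q p N / (\<Prod>j\<in>{..N} - {k}. jtheta (b * q ^ k * q ^ j) p)"
proof -
  define D where "D = (\<Prod>j\<in>{..N} - {k}. jtheta (b * q ^ k * q ^ j) p)"
  have "theta_fact (b * q ^ k) q p (Suc N) = (\<Prod>j\<le>N. jtheta (b * q ^ k * q ^ j) p)"
    by (simp only: theta_fact_def lessThan_Suc_atMost)
  also have "\<dots> = jtheta (b * q ^ k * q ^ k) p * D"
    unfolding D_def using k by (intro prod.remove) auto
  also have "b * q ^ k * q ^ k = b * q ^ (2 * k)"
    by (simp only: mult_2 power_add mult.assoc)
  finally have full: "jtheta (b * q ^ (2 * k)) p * D = theta_fact (b * q ^ k) q p (Suc N)"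
    by (rule sym)
  have "theta_fact b q p k * theta_fact (b * q ^ k) q p (Suc N) = theta_fact b q p (k + Suc N)"
    by (rule theta_fact_add[symmetric])
  also have "k + Suc N = Suc N + k"
    by (rule add.commute)
  also have "theta_fact b q p \<dots> = theta_fact b q p (Suc N) * theta_fact (b * q ^ Suc N) q p k"
    by (rule theta_fact_add)
  finally have eq: "theta_fact b q p k * (jtheta (b * q ^ (2 * k)) p * D) =
      jtheta b p * theta_fact (b * q) q p N * theta_fact (b * q ^ Suc N) q p k"
    by (simp only: full theta_fact_Suc_shift[of b])
  have "jtheta b p \<noteq> 0" "theta_fact (b * q) q p N \<noteq> 0" "theta_fact (b * q ^ Suc N) q p k \<noteq> 0"
    using nz theta_fact_nonzero_mono[OF nz(2) k] by (auto simp: theta_fact_Suc_shift)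
  then have ne: "jtheta b p * theta_fact (b * q ^ Suc N) q p k \<noteq> 0" and D: "D \<noteq> 0"
    using eq by auto
  have "jtheta (b * q ^ (2 * k)) p * theta_fact b q p k * D =
      theta_fact b q p k * (jtheta (b * q ^ (2 * k)) p * D)"
    by (simp only: mult_ac)
  also note eq
  also have "jtheta b p * theta_fact (b * q) q p N * theta_fact (b * q ^ Suc N) q p k =
      theta_fact (b * q) q p N * (jtheta b p * theta_fact (b * q ^ Suc N) q p k)"
    by (simp only: mult_ac)
  finally show ?thesis
    unfolding D_def[symmetric] frac_eq_eq[OF ne D] .
qed

text \<open>
  Theta at the quotients of the nodes: those \<open>z j / z k = q\<^sup>j / q\<^sup>k\<close> with \<open>j < k\<close> have to be inverted,
  and so have the factors of \<open>(q\<^sup>-\<^sup>N)\<^sub>k\<close>. The powers of \<open>q\<close> from both inversions make up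
  \<open>q\<^sup>k (q\<^sup>N)\<^sup>k\<close>, whose second factor is the one that the parameters \<open>A i\<close> contribute.
\<close>

lemma terminating_factor:
  assumes p: "norm p < 1" and q: "q \<noteq> 0" and k: "k \<le> N" and nz: "theta_fact q q p N \<noteq> 0"
  shows "theta_fact (1 / q ^ N) q p k / theta_fact q q p k * q ^ k * (q ^ N) ^ k =
    theta_fact q q p N / (\<Prod>j\<in>{..N} - {k}. jtheta (q ^ j / q ^ k) p)"
proof -
  define E where "E = (\<Prod>j\<in>{..N} - {k}. jtheta (q ^ j / q ^ k) p)"
  have E: "E = theta_fact (1 / q ^ k) q p k * theta_fact q q p (N - k)"
    using theta_fact_skip[OF k, of "1 / q ^ k" q p] q by (simp add: E_def)
  have 1: "theta_fact q q p k = rev_factor q k * theta_fact (1 / q ^ k) q p k"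
    using theta_fact_reverse[OF p q, of 1 k] by simp
  have e: "q ^ N = q ^ k * q ^ (N - k)"
    using k by (simp flip: power_add)
  have 2: "theta_fact (q * q ^ (N - k)) q p k =
      rev_factor q k * (q ^ (N - k)) ^ k * theta_fact (1 / q ^ N) q p k"
    using theta_fact_reverse[OF p q, of "1 / q ^ (N - k)" k] q by (simp add: e power_one_over mult.commute)
  have 3: "theta_fact q q p N = theta_fact q q p (N - k) * theta_fact (q * q ^ (N - k)) q p k"
    using theta_fact_add[of q q p "N - k" k] k by simp
  have "theta_fact q q p N * theta_fact q q p k =
      (rev_factor q k * rev_factor q k) * (q ^ (N - k)) ^ k * E * theta_fact (1 / q ^ N) q p k"
    unfolding 1 2 3 E by (simp add: mult_ac)
  also have "(rev_factor q k * rev_factor q k) * (q ^ (N - k)) ^ k = q ^ k * (q ^ N) ^ k"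
    unfolding rev_factor_square e by (simp add: power_mult_distrib power_mult)
  finally have eq: "theta_fact q q p N * theta_fact q q p k =
      theta_fact (1 / q ^ N) q p k * q ^ k * (q ^ N) ^ k * E"
    by (simp add: mult_ac)
  have nzk: "theta_fact q q p k \<noteq> 0"
    by (rule theta_fact_nonzero_mono[OF nz k])
  have E0: "E \<noteq> 0"
    using nzk 1 3 nz unfolding E by auto
  have "theta_fact (1 / q ^ N) q p k / theta_fact q q p k * q ^ k * (q ^ N) ^ k =
      theta_fact (1 / q ^ N) q p k * q ^ k * (q ^ N) ^ k / theta_fact q q p k"
    by simp
  then show ?thesis
    unfolding E_def[symmetric] frac_eq_eq[OF nzk E0] using eq[symmetric]
    by (simp only: frac_eq_eq[OF nzk E0])
qed

text \<open>
  The summand and the value of the series, with the factors grouped as the preceding lemmas need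
  them. The variable \<open>C\<close> is the last argument because both are studied as functions of \<open>C\<close>, and
  \<open>N\<close> is a separate argument that becomes the sum of the numbers \<open>r i\<close>.
\<close>

definition vwp_term :: "complex \<Rightarrow> complex \<Rightarrow> complex \<Rightarrow> nat \<Rightarrow>
    'i set \<Rightarrow> ('i \<Rightarrow> complex) \<Rightarrow> ('i \<Rightarrow> nat) \<Rightarrow> nat \<Rightarrow> complex \<Rightarrow> complex" where
  "vwp_term p q x N I A r n C =
     jtheta (C\<^sup>2 * q ^ (2 * n)) p * theta_fact (C\<^sup>2) q p n /
       (jtheta (C\<^sup>2) p * theta_fact (C\<^sup>2 * q ^ Suc N) q p n) *
     (theta_fact (C / x) q p n / theta_fact (C / x * q) q p n) *
     (theta_fact (C * x) q p n / theta_fact (C * x * q) q p n) *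
     (theta_fact (1 / q ^ N) q p n / theta_fact q q p n * q ^ n) *
     (\<Prod>i\<in>I. theta_fact (A i * C * q ^ r i) q p n * theta_fact (C * q / A i) q p n /
        (theta_fact (C * q / (A i * q ^ r i)) q p n * theta_fact (A i * C) q p n))"

definition vwp_value :: "complex \<Rightarrow> complex \<Rightarrow> complex \<Rightarrow> nat \<Rightarrow>
    'i set \<Rightarrow> ('i \<Rightarrow> complex) \<Rightarrow> ('i \<Rightarrow> nat) \<Rightarrow> complex \<Rightarrow> complex" where
  "vwp_value p q x N I A r C =
     theta_fact q q p N * theta_fact (C\<^sup>2 * q) q p N /
       (theta_fact (C / x * q) q p N * theta_fact (C * x * q) q p N) *
     (\<Prod>i\<in>I. theta_fact (A i * x) q p (r i) * theta_fact (A i / x) q p (r i) /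
        (theta_fact (A i * C) q p (r i) * theta_fact (A i / C) q p (r i)))"

lemma jtheta_power_quotient_nonzero:
  assumes p: "norm p < 1" and q: "q \<noteq> 0" and nz: "theta_fact q q p N \<noteq> 0"
    and jk: "j \<le> N" "k \<le> N" "j \<noteq> k"
  shows "jtheta (q ^ j / q ^ k) p \<noteq> 0"
proof -
  have pos: "jtheta (q ^ j / q ^ k) p \<noteq> 0" if "k < j" "j \<le> N" for j k
  proof -
    obtain d where d: "j = Suc (k + d)"
      using less_imp_Suc_add[OF \<open>k < j\<close>] by blast
    then have "q ^ j / q ^ k = q * q ^ d"
      using q by (simp add: power_add)
    moreover have "d < N"
      using that(2) d by simp
    ultimately show ?thesis
      using nz by (simp add: theta_fact_nonzero_iff)
  qed
  show ?thesis
  proof (cases "k < j")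
    case False
    then have "jtheta (q ^ k / q ^ j) p \<noteq> 0"
      using pos[of j k] jk by simp
    then show ?thesis
      using jtheta_inverse[OF p, of "q ^ k / q ^ j"] q by simp
  qed (use pos jk in simp)
qed

text \<open>
  If the numbers \<open>C\<^sup>2 q\<^sup>j\<close> are not zeros of theta, the nodes \<open>C q\<^sup>k\<close> are admissible, and the series is
  the interpolation formula for the product \<open>F x\<close> of the \<open>(A i x)\<close> and \<open>(A i / x)\<close> factorials, divided by
  \<open>F C\<close> and by the theta factors of the nodes \<open>C q, \<dots>, C q\<^sup>N\<close> at \<open>x\<close>, up to a constant factor.
\<close>

lemma vwp_sum_generic:
  assumes p: "norm p < 1" and I: "finite I" and N: "N = sum r I"
    and nonzero: "q \<noteq> 0" "C \<noteq> 0" "x \<noteq> 0" "\<And>i. i \<in> I \<Longrightarrow> A i \<noteq> 0"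
    and nz_q: "theta_fact q q p N \<noteq> 0"
    and nz_base: "theta_fact (C\<^sup>2) q p (Suc N) \<noteq> 0" "theta_fact (C\<^sup>2 * q ^ Suc N) q p N \<noteq> 0"
    and nz_x: "theta_fact (C / x * q) q p N \<noteq> 0" "theta_fact (C * x * q) q p N \<noteq> 0"
    and nz_A: "\<And>i. i \<in> I \<Longrightarrow> theta_fact (A i * C) q p N \<noteq> 0"
      "\<And>i. i \<in> I \<Longrightarrow> theta_fact (C * q / (A i * q ^ r i)) q p N \<noteq> 0"
      "\<And>i. i \<in> I \<Longrightarrow> theta_fact (A i * C) q p (r i) \<noteq> 0"
      "\<And>i. i \<in> I \<Longrightarrow> theta_fact (A i / C) q p (r i) \<noteq> 0"
  shows "(\<Sum>n\<le>N. vwp_term p q x N I A r n C) = vwp_value p q x N I A r C"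
proof -
  define F where "F y = (\<Prod>i\<in>I. theta_fact (A i * y) q p (r i) * theta_fact (A i / y) q p (r i))" for y
  define l where "l k = (\<Prod>j\<in>{..N} - {k}. jtheta (C * q ^ j * x) p * jtheta (C * q ^ j / x) p /
          (jtheta (C * q ^ j * (C * q ^ k)) p * jtheta (C * q ^ j / (C * q ^ k)) p))" for k
  define K where "K = theta_fact q q p N * theta_fact (C\<^sup>2 * q) q p N /
       (theta_fact (C / x * q) q p N * theta_fact (C * x * q) q p N)"
  have FC: "F C \<noteq> 0"
    using I nz_A by (simp add: F_def)
  \<comment> \<open>\<open>F\<close> is a product of \<open>N\<close> factors, which are indexed by the pairs \<open>(i, s)\<close> with \<open>s < r i\<close>.\<close>
  have F_Sigma: "F y = (\<Prod>(i, s)\<in>Sigma I (\<lambda>i. {..<r i}). jtheta (A i * q ^ s * y) p * jtheta (A i * q ^ s / y) p)" for y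
    unfolding F_def theta_fact_def prod.distrib[symmetric] using I
    by (subst prod.Sigma) (simp_all add: mult_ac)
  have interpolation: "F x = (\<Sum>k\<le>N. F (C * q ^ k) * l k)"
    unfolding F_Sigma l_def case_prod_unfold
  proof (rule theta_interpolation[OF p])
    show "card (SIGMA i:I. {..<r i}) = N"
      using I by (simp add: N)
    fix j k assume jk: "j \<le> N" "k \<le> N" "j \<noteq> k"
    \<comment> \<open>The two conditions on the base join to one up to exponent \<open>2 N\<close>, which bounds \<open>j + k\<close>.\<close>
    have "theta_fact (C\<^sup>2) q p (Suc N + N) \<noteq> 0"
      using nz_base theta_fact_add[of "C\<^sup>2" q p "Suc N" N] by simp
    moreover have "j + k < Suc N + N"
      using jk by simp
    ultimately have "jtheta (C\<^sup>2 * q ^ (j + k)) p \<noteq> 0"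
      unfolding theta_fact_nonzero_iff by blast
    moreover have "jtheta (q ^ j / q ^ k) p \<noteq> 0"
      by (rule jtheta_power_quotient_nonzero[OF p nonzero(1) nz_q jk])
    ultimately show "jtheta (C * q ^ j * (C * q ^ k)) p * jtheta (C * q ^ j / (C * q ^ k)) p \<noteq> 0"
      using nonzero(2) by (simp add: power2_eq_square power_add mult_ac)
  qed (use I nonzero in auto)
  have "vwp_term p q x N I A r k C = K / F C * (F (C * q ^ k) * l k)" if k: "k \<le> N" for k
  proof -
    define X1 X2 D E where "X1 = (\<Prod>j\<in>{..N} - {k}. jtheta (C / x * q ^ j) p)"
      and "X2 = (\<Prod>j\<in>{..N} - {k}. jtheta (C * x * q ^ j) p)"
      and "D = (\<Prod>j\<in>{..N} - {k}. jtheta (C\<^sup>2 * q ^ k * q ^ j) p)"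
      and "E = (\<Prod>j\<in>{..N} - {k}. jtheta (q ^ j / q ^ k) p)"
    have l: "l k = X2 * X1 / (D * E)"
      unfolding l_def X1_def X2_def D_def E_def prod.distrib[symmetric] prod_dividef[symmetric]
      using nonzero(2) by (intro prod.cong refl) (simp add: power2_eq_square mult_ac)
    have "(\<Prod>i\<in>I. theta_fact (A i * C * q ^ r i) q p k * theta_fact (C * q / A i) q p k /
        (theta_fact (C * q / (A i * q ^ r i)) q p k * theta_fact (A i * C) q p k)) =
       (\<Prod>i\<in>I. (q ^ r i) ^ k * (theta_fact (A i * (C * q ^ k)) q p (r i) * theta_fact (A i / (C * q ^ k)) q p (r i)) /
      (theta_fact (A i * C) q p (r i) * theta_fact (A i / C) q p (r i)))"
      by (intro prod.cong refl parameter_factor p nonzero nz_A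
          theta_fact_nonzero_mono[OF nz_A(1) k] theta_fact_nonzero_mono[OF nz_A(2) k])
    also have "\<dots> = (\<Prod>i\<in>I. (q ^ r i) ^ k) * F (C * q ^ k) / F C"
      by (simp only: prod_dividef prod.distrib F_def)
    also have "(\<Prod>i\<in>I. (q ^ r i) ^ k) = (q ^ N) ^ k"
      by (simp add: N power_sum prod_power_distrib)
    finally have par: "(\<Prod>i\<in>I. theta_fact (A i * C * q ^ r i) q p k * theta_fact (C * q / A i) q p k /
        (theta_fact (C * q / (A i * q ^ r i)) q p k * theta_fact (A i * C) q p k)) =
        (q ^ N) ^ k * F (C * q ^ k) / F C" .
    have "vwp_term p q x N I A r k C =
        theta_fact (C\<^sup>2 * q) q p N / D *
        (X1 / theta_fact (C / x * q) q p N) * (X2 / theta_fact (C * x * q) q p N) *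
        (theta_fact (1 / q ^ N) q p k / theta_fact q q p k * q ^ k * (q ^ N) ^ k) *
        (F (C * q ^ k) / F C)"
      unfolding vwp_term_def par base_factor[OF k nz_base] argument_factor[OF k nz_x(1)]
        argument_factor[OF k nz_x(2)] X1_def X2_def D_def
      by simp
    also have "\<dots> = K / F C * (F (C * q ^ k) * l k)"
      unfolding terminating_factor[OF p nonzero(1) k nz_q] l K_def E_def[symmetric]
      by (simp add: mult_ac)
    finally show ?thesis .
  qed
  then have "(\<Sum>n\<le>N. vwp_term p q x N I A r n C) = K / F C * (\<Sum>k\<le>N. F (C * q ^ k) * l k)"
    by (simp add: sum_distrib_left)
  also have "\<dots> = K * (F x / F C)"
    by (simp flip: interpolation)
  also have "\<dots> = vwp_value p q x N I A r C"
    by (simp add: K_def F_def vwp_value_def prod_dividef)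
  finally show ?thesis .
qed

section \<open>Removing the genericity condition\<close>

lemma tendsto_jtheta [tendsto_intros]:
  assumes "(f \<longlongrightarrow> l) F" "norm p < 1" "l \<noteq> 0"
  shows "((\<lambda>c. jtheta (f c) p) \<longlongrightarrow> jtheta l p) F"
  using isCont_tendsto_compose[OF isCont_jtheta[OF assms(2,3)] assms(1)] .

lemma tendsto_theta_fact [tendsto_intros]:
  assumes "(f \<longlongrightarrow> l) F" "norm p < 1" "q \<noteq> 0" "l \<noteq> 0"
  shows "((\<lambda>c. theta_fact (f c) q p n) \<longlongrightarrow> theta_fact l q p n) F"
  unfolding theta_fact_def by (intro tendsto_intros assms) (use assms in auto)

lemma countable_square_jtheta_zeros:
  assumes p: "norm p < 1" and q: "q \<noteq> 0"
  shows "countable {C. C \<noteq> 0 \<and> jtheta (C\<^sup>2 * q ^ j) p = 0}"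
proof -
  define Z where "Z = range (\<lambda>n. 1 / p ^ n) \<union> range (\<lambda>n. p ^ (n + 1))"
  have "{C. C \<noteq> 0 \<and> jtheta (C\<^sup>2 * q ^ j) p = 0} \<subseteq>
      (\<lambda>z. csqrt (z / q ^ j)) ` Z \<union> (\<lambda>z. - csqrt (z / q ^ j)) ` Z"
  proof
    fix C assume "C \<in> {C. C \<noteq> 0 \<and> jtheta (C\<^sup>2 * q ^ j) p = 0}"
    then have z: "C\<^sup>2 * q ^ j \<in> Z"
      unfolding Z_def by (intro jtheta_zeros p) (use q in auto)
    have "(csqrt (C\<^sup>2 * q ^ j / q ^ j))\<^sup>2 = C\<^sup>2"
      using q by simp
    then have "C = csqrt (C\<^sup>2 * q ^ j / q ^ j) \<or> C = - csqrt (C\<^sup>2 * q ^ j / q ^ j)"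
      by (metis power2_eq_iff)
    then show "C \<in> (\<lambda>z. csqrt (z / q ^ j)) ` Z \<union> (\<lambda>z. - csqrt (z / q ^ j)) ` Z"
      using z by blast
  qed
  moreover have "countable Z"
    by (simp add: Z_def)
  ultimately show ?thesis
    using countable_subset by (metis (no_types, lifting) countable_Un countable_image)
qed

text \<open>
  Zeros of theta at \<open>C\<^sup>2 q\<^sup>j\<close> with \<open>1 \<le> j \<le> N\<close> make two nodes dependent, although the denominators of
  the series and of its value may all be nonzero. Both sides are then continuous in \<open>C\<close>, and the
  exceptional \<open>C\<close> form a countable set, so these cases are limits of generic ones.
\<close>

lemma vwp_sum:
  assumes p: "norm p < 1" and I: "finite I" and N: "N = sum r I"
    and nonzero: "q \<noteq> 0" "C \<noteq> 0" "x \<noteq> 0" "\<And>i. i \<in> I \<Longrightarrow> A i \<noteq> 0"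
    and nz_q: "theta_fact q q p N \<noteq> 0"
    and nz_base: "jtheta (C\<^sup>2) p \<noteq> 0" "theta_fact (C\<^sup>2 * q ^ Suc N) q p N \<noteq> 0"
    and nz_x: "theta_fact (C / x * q) q p N \<noteq> 0" "theta_fact (C * x * q) q p N \<noteq> 0"
    and nz_A: "\<And>i. i \<in> I \<Longrightarrow> theta_fact (A i * C) q p N \<noteq> 0"
      "\<And>i. i \<in> I \<Longrightarrow> theta_fact (C * q / (A i * q ^ r i)) q p N \<noteq> 0"
      "\<And>i. i \<in> I \<Longrightarrow> theta_fact (A i * C) q p (r i) \<noteq> 0"
      "\<And>i. i \<in> I \<Longrightarrow> theta_fact (A i / C) q p (r i) \<noteq> 0"
  shows "(\<Sum>n\<le>N. vwp_term p q x N I A r n C) = vwp_value p q x N I A r C"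
proof -
  define Bad where "Bad = (\<Union>j\<le>N. {c. c \<noteq> 0 \<and> jtheta (c\<^sup>2 * q ^ j) p = 0})"
  define G where "G = at C within - Bad"
  have "countable Bad"
    unfolding Bad_def by (intro countable_UN countable_square_jtheta_zeros p nonzero) auto
  have "C islimpt (- Bad)"
    unfolding islimpt_approachable
  proof (intro allI impI)
    fix e :: real assume "e > 0"
    then have "uncountable (ball C e)"
      by (rule uncountable_ball)
    then have "\<not> ball C e \<subseteq> insert C Bad"
      using \<open>countable Bad\<close> by (meson countable_insert countable_subset)
    then show "\<exists>c\<in>- Bad. c \<noteq> C \<and> dist c C < e"
      by (auto simp: dist_commute)
  qed
  then have G: "G \<noteq> bot"
    by (simp add: G_def trivial_limit_within)
  have lim: "((\<lambda>c. c) \<longlongrightarrow> C) G"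
    unfolding G_def by (rule tendsto_ident_at)
  have nz: "theta_fact q q p n \<noteq> 0" "theta_fact (C\<^sup>2 * q ^ Suc N) q p n \<noteq> 0"
      "theta_fact (C / x * q) q p n \<noteq> 0" "theta_fact (C * x * q) q p n \<noteq> 0"
      "\<And>i. i \<in> I \<Longrightarrow> theta_fact (A i * C) q p n \<noteq> 0"
      "\<And>i. i \<in> I \<Longrightarrow> theta_fact (C * q / (A i * q ^ r i)) q p n \<noteq> 0" if "n \<le> N" for n
    using that theta_fact_nonzero_mono nz_q nz_base nz_x nz_A by blast+
  have "((\<lambda>c. vwp_term p q x N I A r n c) \<longlongrightarrow> vwp_term p q x N I A r n C) G" if "n \<le> N" for n
    unfolding vwp_term_def
    by (intro tendsto_intros lim p) (use nonzero nz[OF that] nz_base in auto)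
  then have lhs: "((\<lambda>c. \<Sum>n\<le>N. vwp_term p q x N I A r n c) \<longlongrightarrow> (\<Sum>n\<le>N. vwp_term p q x N I A r n C)) G"
    by (intro tendsto_sum) auto
  have rhs: "((\<lambda>c. vwp_value p q x N I A r c) \<longlongrightarrow> vwp_value p q x N I A r C) G"
    unfolding vwp_value_def
    by (intro tendsto_intros lim p) (use nonzero nz_x nz_A in auto)
  have ne: "eventually (\<lambda>c. f c \<noteq> 0) G" if "(f \<longlongrightarrow> l) G" "l \<noteq> 0" for f :: "complex \<Rightarrow> complex" and l
    using tendsto_imp_eventually_ne[OF that] .
  have ne_all: "eventually (\<lambda>c. \<forall>i\<in>I. f i c \<noteq> 0) G"
    if "\<And>i. i \<in> I \<Longrightarrow> (f i \<longlongrightarrow> l i) G" "\<And>i. i \<in> I \<Longrightarrow> l i \<noteq> 0" for f :: "_ \<Rightarrow> complex \<Rightarrow> complex" and l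
    using I that by (intro eventually_ball_finite ballI ne) auto
  have "eventually (\<lambda>c. c \<noteq> 0) G"
    by (rule ne[OF lim nonzero(2)])
  moreover have "eventually (\<lambda>c. c \<notin> Bad) G"
    unfolding G_def by (simp add: eventually_at_filter)
  moreover have "eventually (\<lambda>c. theta_fact (c\<^sup>2 * q ^ Suc N) q p N \<noteq> 0) G"
    by (rule ne[OF _ nz_base(2)]) (intro tendsto_intros lim p, use nonzero in auto)
  moreover have "eventually (\<lambda>c. theta_fact (c / x * q) q p N \<noteq> 0) G"
    by (rule ne[OF _ nz_x(1)]) (intro tendsto_intros lim p, use nonzero in auto)
  moreover have "eventually (\<lambda>c. theta_fact (c * x * q) q p N \<noteq> 0) G"
    by (rule ne[OF _ nz_x(2)]) (intro tendsto_intros lim p, use nonzero in auto)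
  moreover have "eventually (\<lambda>c. \<forall>i\<in>I. theta_fact (A i * c) q p N \<noteq> 0) G"
    by (rule ne_all[where l = "\<lambda>i. theta_fact (A i * C) q p N", OF _ nz_A(1)]) (intro tendsto_intros lim p, use nonzero in auto)
  moreover have "eventually (\<lambda>c. \<forall>i\<in>I. theta_fact (c * q / (A i * q ^ r i)) q p N \<noteq> 0) G"
    by (rule ne_all[where l = "\<lambda>i. theta_fact (C * q / (A i * q ^ r i)) q p N", OF _ nz_A(2)]) (intro tendsto_intros lim p, use nonzero in auto)
  moreover have "eventually (\<lambda>c. \<forall>i\<in>I. theta_fact (A i * c) q p (r i) \<noteq> 0) G"
    by (rule ne_all[where l = "\<lambda>i. theta_fact (A i * C) q p (r i)", OF _ nz_A(3)]) (intro tendsto_intros lim p, use nonzero in auto)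
  moreover have "eventually (\<lambda>c. \<forall>i\<in>I. theta_fact (A i / c) q p (r i) \<noteq> 0) G"
    by (rule ne_all[where l = "\<lambda>i. theta_fact (A i / C) q p (r i)", OF _ nz_A(4)]) (intro tendsto_intros lim p, use nonzero in auto)
  ultimately have "eventually (\<lambda>c. (\<Sum>n\<le>N. vwp_term p q x N I A r n c) = vwp_value p q x N I A r c) G"
  proof eventually_elim
    case (elim c)
    have "theta_fact (c\<^sup>2) q p (Suc N) \<noteq> 0"
      using elim(1,2) by (auto simp: theta_fact_nonzero_iff Bad_def less_Suc_eq_le)
    with elim show ?case
      by (intro vwp_sum_generic p I N nonzero nz_q) auto
  qed
  then have "((\<lambda>c. \<Sum>n\<le>N. vwp_term p q x N I A r n c) \<longlongrightarrow> vwp_value p q x N I A r C) G"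
    using rhs by (simp add: tendsto_cong)
  with lhs show ?thesis
    by (rule tendsto_unique[OF G])
qed

section \<open>The summation formula\<close>

lemma prod_list_map_upt: "(\<Prod>i\<leftarrow>[a..<Suc b]. f i) = (\<Prod>i=a..b. f i)" for f :: "nat \<Rightarrow> 'a :: comm_monoid_mult"
  using prod.distinct_set_conv_list[of "[a..<Suc b]" f]
  by (simp add: atLeastLessThanSuc_atLeastAtMost del: upt_Suc)

theorem corollary4p9:
  fixes p q C x :: complex and m N :: nat and Ns :: "nat \<Rightarrow> nat" and A :: "nat \<Rightarrow> complex"
    and bs :: "complex list"
  assumes p: "norm p < 1"
    and m: "m \<ge> 1"
    and N: "N = (\<Sum>i=1..m. Ns i)"
    and nonzero: "q \<noteq> 0" "C \<noteq> 0" "x \<noteq> 0" "\<And>i. i \<in> {1..m} \<Longrightarrow> A i \<noteq> 0"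
    and bs: "bs = [C / x, C * x, q powi (- int N)]
                  @ map (\<lambda>i. A i * C * q ^ Ns i) [1..<Suc m]
                  @ map (\<lambda>i. C * q / A i) [1..<Suc m]"
    and lhs_denominators:
      "jtheta (C\<^sup>2) p \<noteq> 0"
      "\<And>n. n \<le> N \<Longrightarrow> theta_facts (q # map (\<lambda>b. C\<^sup>2 * q / b) bs) q p n \<noteq> 0"
    and rhs_denominators:
      "theta_facts [C * x * q, C * q / x] q p N \<noteq> 0"
      "\<And>i. i \<in> {1..m} \<Longrightarrow> theta_facts [A i * C, A i / C] q p (Ns i) \<noteq> 0"
  shows "ellV (C\<^sup>2) bs q p =
           theta_facts [q, C\<^sup>2 * q] q p N / theta_facts [C * x * q, C * q / x] q p N *
           (\<Prod>i=1..m. theta_facts [A i * x, A i / x] q p (Ns i) /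
                        theta_facts [A i * C, A i / C] q p (Ns i))"
proof -
  \<comment> \<open>It remains to translate the parameter lists into products over \<open>i\<close> and to cut the series at \<open>N\<close>.\<close>
  have qN: "q powi (- int N) = 1 / q ^ N"
    by (simp add: power_int_minus inverse_eq_divide)
  have num: "theta_facts (C\<^sup>2 # bs) q p n = theta_fact (C\<^sup>2) q p n * (theta_fact (C / x) q p n *
      (theta_fact (C * x) q p n * (theta_fact (1 / q ^ N) q p n *
      ((\<Prod>i=1..m. theta_fact (A i * C * q ^ Ns i) q p n) * (\<Prod>i=1..m. theta_fact (C * q / A i) q p n)))))" for n
    unfolding theta_facts_def bs qN prod_list_map_upt[symmetric] by (simp add: o_def del: upt_Suc)
  have map_bs: "map (\<lambda>b. C\<^sup>2 * q / b) bs = [C * x * q, C / x * q, C\<^sup>2 * q ^ Suc N]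
      @ map (\<lambda>i. C * q / (A i * q ^ Ns i)) [1..<Suc m] @ map (\<lambda>i. A i * C) [1..<Suc m]"
  proof -
    have 1: "C\<^sup>2 * q / (C / x) = C * x * q" "C\<^sup>2 * q / (C * x) = C / x * q"
        "C\<^sup>2 * q / (1 / q ^ N) = C\<^sup>2 * q ^ Suc N"
      using nonzero(2) by (simp_all add: power2_eq_square)
    have 2: "map ((\<lambda>b. C\<^sup>2 * q / b) \<circ> (\<lambda>i. A i * C * q ^ Ns i)) [1..<Suc m] =
        map (\<lambda>i. C * q / (A i * q ^ Ns i)) [1..<Suc m]"
      using nonzero(2) by (intro map_cong refl) (simp add: power2_eq_square)
    have 3: "map ((\<lambda>b. C\<^sup>2 * q / b) \<circ> (\<lambda>i. C * q / A i)) [1..<Suc m] =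
        map (\<lambda>i. A i * C) [1..<Suc m]"
    proof (intro map_cong refl)
      fix i assume "i \<in> set [1..<Suc m]"
      then have "A i \<noteq> 0" using nonzero(4)[of i] by auto
      then show "((\<lambda>b. C\<^sup>2 * q / b) \<circ> (\<lambda>i. C * q / A i)) i = A i * C"
        using nonzero(1,2) by (simp add: power2_eq_square)
    qed
    show ?thesis
      by (simp only: bs qN map_append list.map map_map 1 2 3)
  qed
  have den: "theta_facts (q # map (\<lambda>b. C\<^sup>2 * q / b) bs) q p n = theta_fact q q p n * (theta_fact (C * x * q) q p n *
      (theta_fact (C / x * q) q p n * (theta_fact (C\<^sup>2 * q ^ Suc N) q p n *
      ((\<Prod>i=1..m. theta_fact (C * q / (A i * q ^ Ns i)) q p n) * (\<Prod>i=1..m. theta_fact (A i * C) q p n)))))" for n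
    unfolding theta_facts_def map_bs prod_list_map_upt[symmetric]
    by (simp add: o_def del: upt_Suc power_Suc)
  have den_N: "theta_facts (q # map (\<lambda>b. C\<^sup>2 * q / b) bs) q p N \<noteq> 0"
    by (rule lhs_denominators) simp
  define t where "t n = jtheta (C\<^sup>2 * q ^ (2 * n)) p / jtheta (C\<^sup>2) p *
      (theta_facts (C\<^sup>2 # bs) q p n / theta_facts (q # map (\<lambda>b. C\<^sup>2 * q / b) bs) q p n) * q ^ n" for n
  have t: "t n = vwp_term p q x N {1..m} A Ns n C" for n
    unfolding t_def num den vwp_term_def prod_dividef prod.distrib
    by (simp only: times_divide_times_eq times_divide_eq_left times_divide_eq_right divide_divide_eq_left mult_ac)
  have "t n = 0" if "n \<notin> {..N}" for n
  proof -
    have "jtheta (1 / q ^ N * q ^ N) p = 0" "N < n"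
      using that nonzero(1) p by simp_all
    then have "theta_fact (1 / q ^ N) q p n = 0"
      using theta_fact_nonzero_iff by blast
    then show ?thesis
      by (simp add: t vwp_term_def)
  qed
  then have "(\<Sum>n. t n) = (\<Sum>n\<le>N. t n)"
    by (intro suminf_finite) auto
  also have "\<dots> = vwp_value p q x N {1..m} A Ns C"
    unfolding t
    by (rule vwp_sum[OF p _ N nonzero])
       (use den_N[unfolded den] lhs_denominators(1) rhs_denominators(2) in
         \<open>simp_all add: theta_facts_def del: power_Suc\<close>)
  finally have "ellV (C\<^sup>2) bs q p = vwp_value p q x N {1..m} A Ns C"
    by (simp add: ellV_def t_def)
  then show ?thesis
    by (simp add: vwp_value_def theta_facts_def mult_ac)
qed

end
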